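(* Let $A=P+T$ be an $n\times n$ $PT$-matrix of type 1. Then $A$ has finite multiplicative order if and only if $n$ is even and either $A$ or its transpose is permutation similar to a matrix of the form $C_n+T(1,n-j,d+1,j)$, where $n=2d$, $1\le j<d$ and $[j]_2\neq[d-j]_2$. In this case the multiplicative order of $A$ is $\mathrm{lcm}(2j,2d-2j,d)$.
   Context: $C_n$ is the $n\times n$ permutation matrix with $1$ in positions $(i+1,i)$ for $1\le i\le n-1$ and in position $(1,n)$ (the companion matrix of $x^n-1$). A $T$-block $T(i_1,j_1,i_2,j_2)$ (with $i_1\ne i_2$, $j_1\ne j_2$) is the $n\times n$ matrix with $1$ in positions $(i_1,j_1),(i_2,j_2)$, $-1$ in positions $(i_1,j_2),(i_2,j_1)$, and $0$ elsewhere. A $PT$-matrix of type 1 is a matrix $P+T$ where $P$ is an $n\times n$ permutation matrix representing a single $n$-cycle and $T$ is a $T$-block whose non-zero positions are disjoint from the positions of the $1$'s of $P$. Matrices $A,B$ are permutation similar if $B=R^TAR$ for a permutation matrix $R$. For a positive integer $t$, $[t]_2$ denotes the highest power of $2$ dividing $t$. *)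

theory Defs
  imports
    "Jordan_Normal_Form.Matrix"
    "HOL-Combinatorics.Orbits"
    "HOL-Combinatorics.Permutations"
    "HOL-Computational_Algebra.Primes"
begin

(* Library matrices are indexed from 0. Rows and columns are numbered 1, ..., n here,
   and this is the only place where the shift occurs. *)
definition mat_of_entries :: "nat \<Rightarrow> (nat \<Rightarrow> nat \<Rightarrow> int) \<Rightarrow> int mat" where
  "mat_of_entries n a = mat n n (\<lambda>(r, c). a (Suc r) (Suc c))"

(* Ones in the positions (\<sigma> j, j). *)
definition perm_mat :: "nat \<Rightarrow> (nat \<Rightarrow> nat) \<Rightarrow> int mat" where
  "perm_mat n \<sigma> = mat_of_entries n (\<lambda>i j. if i = \<sigma> j then 1 else 0)"

definition is_perm_mat :: "nat \<Rightarrow> int mat \<Rightarrow> bool" where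
  "is_perm_mat n P \<longleftrightarrow> (\<exists>\<sigma>. \<sigma> permutes {1..n} \<and> P = perm_mat n \<sigma>)"

definition is_n_cycle_mat :: "nat \<Rightarrow> int mat \<Rightarrow> bool" where
  "is_n_cycle_mat n P \<longleftrightarrow>
     (\<exists>\<sigma>. \<sigma> permutes {1..n} \<and> cyclic_on \<sigma> {1..n} \<and> P = perm_mat n \<sigma>)"

definition C_mat :: "nat \<Rightarrow> int mat" where
  "C_mat n = mat_of_entries n
     (\<lambda>i j. if (1 \<le> j \<and> j \<le> n - 1 \<and> i = j + 1) \<or> (i = 1 \<and> j = n) then 1 else 0)"

(* The T-block T(i1, j1, i2, j2); meaningful only for distinct rows i1, i2 and
   distinct columns j1, j2, all between 1 and n. *)
definition T_mat :: "nat \<Rightarrow> nat \<Rightarrow> nat \<Rightarrow> nat \<Rightarrow> nat \<Rightarrow> int mat" where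
  "T_mat n i1 j1 i2 j2 = mat_of_entries n
     (\<lambda>i j. if (i, j) \<in> {(i1, j1), (i2, j2)} then 1
            else if (i, j) \<in> {(i1, j2), (i2, j1)} then - 1
            else 0)"

definition is_T_block :: "nat \<Rightarrow> int mat \<Rightarrow> bool" where
  "is_T_block n T \<longleftrightarrow>
     (\<exists>i1\<in>{1..n}. \<exists>j1\<in>{1..n}. \<exists>i2\<in>{1..n}. \<exists>j2\<in>{1..n}.
        i1 \<noteq> i2 \<and> j1 \<noteq> j2 \<and> T = T_mat n i1 j1 i2 j2)"

definition is_PT_type1 :: "nat \<Rightarrow> int mat \<Rightarrow> bool" where
  "is_PT_type1 n A \<longleftrightarrow>
     (\<exists>P T. is_n_cycle_mat n P \<and> is_T_block n T \<and>
        {(r, c). r < n \<and> c < n \<and> T $$ (r, c) \<noteq> 0} \<inter>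
        {(r, c). r < n \<and> c < n \<and> P $$ (r, c) = 1} = {} \<and>
        A = P + T)"

definition perm_similar :: "nat \<Rightarrow> int mat \<Rightarrow> int mat \<Rightarrow> bool" where
  "perm_similar n A B \<longleftrightarrow> (\<exists>R. is_perm_mat n R \<and> B = transpose_mat R * A * R)"

(* The exponent 0 has to be excluded, since every matrix satisfies A^0 = 1. *)
definition has_finite_order :: "int mat \<Rightarrow> bool" where
  "has_finite_order A \<longleftrightarrow> (\<exists>k>0. A ^\<^sub>m k = 1\<^sub>m (dim_row A))"

definition mult_order :: "int mat \<Rightarrow> nat" where
  "mult_order A = (LEAST k. k > 0 \<and> A ^\<^sub>m k = 1\<^sub>m (dim_row A))"

definition two_part :: "nat \<Rightarrow> nat" where
  "two_part t = 2 ^ multiplicity 2 t"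

end

theory Submission
  imports Defs
    "HOL-Computational_Algebra.Computational_Algebra"
    "HOL-Computational_Algebra.Field_as_Ring"
    "HOL-Number_Theory.Cong"
begin

text \<open>
  Number the rows along the cycle of \<open>P\<close>, so that \<open>A\<close> becomes the cyclic shift plus the rank-one
  matrix \<open>u v\<^sup>T\<close>, where \<open>u\<close> and \<open>v\<close> are differences of unit vectors. The resolvent of a rank-one
  perturbation expresses the generating functions of the entries of \<open>A\<^sup>k\<close> through those of the
  shift, with denominator the reversed characteristic polynomial
  \<open>F = 1 - z\<^sup>n - z\<^bsup>q1\<^esup> + z\<^bsup>q2\<^esup> + z\<^bsup>q3\<^esup> - z\<^bsup>q4\<^esup>\<close>. If \<open>A\<^sup>N = 1\<close>, then \<open>F\<close> divides
  \<open>(1 - z\<^sup>n) (1 - z\<^sup>N)\<close>, hence its roots lie on the unit circle and have multiplicity at most two.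
  The first property forces \<open>F\<close> to be anti-palindromic, which leaves \<open>n = 2 d\<close> and
  \<open>F = (1 \<plusminus> z\<^sup>j) (1 \<plusminus> z\<^bsup>d - j\<^esup>) (1 - z\<^sup>d)\<close>; the second one excludes the minus signs and the case
  in which \<open>j\<close> and \<open>d - j\<close> have the same 2-part. The exponents of \<open>F\<close> determine \<open>A\<close> up to
  permutation similarity and transposition. Conversely, for different 2-parts the factors of \<open>F\<close>
  are coprime, so \<open>F\<close> divides \<open>1 - z\<^sup>L\<close>, and thus \<open>A\<^sup>L = 1\<close>, exactly for the multiples \<open>L\<close>
  of the claimed order.
\<close>

section \<open>Generating functions of the matrix powers\<close>

no_notation vec_index (infixl "$" 100)

text \<open>For n > 0 this is z^(r mod n) / (1 - z^n). The k-th power of the cyclic shift has entry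
  1 at (m, q) exactly for k congruent to m - q, so \<open>prog_fps n (m - q)\<close> is an entry of
  the resolvent of the shift.\<close>

definition prog_fps :: "nat \<Rightarrow> int \<Rightarrow> complex fps" where
  "prog_fps n r = Abs_fps (\<lambda>k. of_bool ([int k = r] (mod int n)))"

lemma prog_fps_rec:
  "prog_fps n r = of_bool ([r = 0] (mod int n)) + fps_X * prog_fps n (r - 1)"
proof (rule fps_ext)
  fix k show "prog_fps n r $ k = (of_bool ([r = 0] (mod int n)) + fps_X * prog_fps n (r - 1)) $ k"
  proof (cases k)
    case 0
    then show ?thesis by (auto simp: prog_fps_def cong_sym_eq)
  next
    case (Suc l)
    have "[int l = r - 1] (mod int n) \<longleftrightarrow> [int (Suc l) = r] (mod int n)"
      using cong_add_rcancel[of "int l" 1 "r - 1" "int n"] by (simp add: add.commute)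
    then show ?thesis using Suc by (simp add: prog_fps_def of_bool_def)
  qed
qed

abbreviation residue_monom :: "nat \<Rightarrow> int \<Rightarrow> complex poly" where
  "residue_monom n r \<equiv> monom 1 (nat (r mod int n))"

lemma prog_fps_mult:
  assumes "n > 0"
  shows "(1 - fps_X ^ n) * prog_fps n r = fps_of_poly (residue_monom n r)"
proof (rule fps_ext)
  fix k
  have *: "[int k = r] (mod int n) \<longleftrightarrow> k = nat (r mod int n)" if "k < n"
    using that assms by (auto simp: cong_def nat_eq_iff)
  have lt: "nat (r mod int n) < n" using assms by (simp add: nat_less_iff)
  have **: "[int (k - n) = r] (mod int n) \<longleftrightarrow> [int k = r] (mod int n)" if "\<not> k < n"
    using that by (simp add: of_nat_diff cong_def)
  show "((1 - fps_X ^ n) * prog_fps n r) $ k = fps_of_poly (residue_monom n r) $ k"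
    using * ** lt by (auto simp: ring_distribs fps_X_power_mult_nth prog_fps_def not_less)
qed

text \<open>Multiplication by 1 - z^N subtracts from the series its own shift by one period, so only
  the first N coefficients survive.\<close>

lemma periodic_fps_poly:
  assumes "\<And>k. f $ (k + N) = (f $ k :: complex)"
  shows "\<exists>p. (1 - fps_X ^ N) * f = fps_of_poly p"
proof -
  have "(1 - fps_X ^ N) * f = fps_of_poly (Poly (map (fps_nth f) [0..<N]))"
  proof (rule fps_ext)
    fix k
    show "((1 - fps_X ^ N) * f) $ k = fps_of_poly (Poly (map (fps_nth f) [0..<N])) $ k"
      using assms[of "k - N"]
      by (auto simp: ring_distribs fps_X_power_mult_nth nth_default_def)
  qed
  then show ?thesis by blast
qed

section \<open>Labelling along the cycle and the resolvent\<close>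

lemma pow_mat_add_exponent:
  assumes "A \<in> carrier_mat n n"
  shows "A ^\<^sub>m (k + l) = A ^\<^sub>m k * A ^\<^sub>m l"
proof (induction l)
  case (Suc l)
  have "A ^\<^sub>m (k + Suc l) = A ^\<^sub>m k * A ^\<^sub>m l * A" using Suc by simp
  also have "\<dots> = A ^\<^sub>m k * (A ^\<^sub>m l * A)"
    using assms by (intro assoc_mult_mat) auto
  finally show ?case by simp
qed (use assms in simp)

text \<open>Integer labels modulo \<open>n\<close> follow the cycle of P: the permutation part sends
  label q to q + 1. Rows a, b support u and columns c, e support v. Integers allow differences of
  labels to be formed freely. Column q of P has its 1 in row q + 1, so \<open>disjoint\<close> says
  that the T-block avoids these ones.\<close>

locale labelled_PT =
  fixes n :: nat and A :: "int mat" and \<phi> :: "int \<Rightarrow> nat" and a b c e :: int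
  assumes n_pos: "n > 0"
    and carrier: "A \<in> carrier_mat n n"
    and range: "range \<phi> = {..<n}"
    and label_eq: "\<phi> x = \<phi> y \<longleftrightarrow> [x = y] (mod int n)"
    and entry: "i < n \<Longrightarrow> A $$ (i, \<phi> q) = of_bool (i = \<phi> (q + 1)) +
      (of_bool (i = \<phi> a) - of_bool (i = \<phi> b)) * (of_bool (\<phi> q = \<phi> c) - of_bool (\<phi> q = \<phi> e))"
    and rows: "\<phi> a \<noteq> \<phi> b" and cols: "\<phi> c \<noteq> \<phi> e"
    and disjoint: "\<phi> (c + 1) \<noteq> \<phi> a" "\<phi> (c + 1) \<noteq> \<phi> b" "\<phi> (e + 1) \<noteq> \<phi> a" "\<phi> (e + 1) \<noteq> \<phi> b"
begin



lemma label_less [simp]: "\<phi> x < n"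
  using range by blast

lemma n_gt_1: "n > 1"
  using rows label_less[of a] label_less[of b] by linarith

text \<open>An entry of the inverse of 1 - z A, embedded into the complex series so that roots of
  denominators become available.\<close>

definition G :: "int \<Rightarrow> int \<Rightarrow> complex fps" where
  "G m q = Abs_fps (\<lambda>k. of_int ((A ^\<^sub>m k) $$ (\<phi> m, \<phi> q)))"

abbreviation "E \<equiv> prog_fps n"
abbreviation "R \<equiv> residue_monom n"
text \<open>With S the cyclic shift, V is the row vector v^T (1 - z S)^(-1), U the column vector (1
  - z S)^(-1) u, and s the scalar v^T (1 - z S)^(-1) u.\<close>

abbreviation "V q \<equiv> E (c - q) - E (e - q)"
abbreviation "U m \<equiv> E (m - a) - E (m - b)"
abbreviation "s \<equiv> E (c - a) - E (c - b) - E (e - a) + E (e - b)"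

text \<open>The polynomial det (1 - z A), which the matrix determinant lemma gives as (1 - z^n) (1 -
  z s); the residue monomials are the numerators of the series in s.\<close>

definition rev_charpoly :: "complex poly" where
  "rev_charpoly = 1 - monom 1 n - monom 1 1 * (R (c - a) - R (c - b) - R (e - a) + R (e - b))"

lemma fps_rev_charpoly: "fps_of_poly rev_charpoly = (1 - fps_X ^ n) * (1 - fps_X * s)"
proof -
  have "(1 - fps_X ^ n) * (1 - fps_X * s) = (1 - fps_X ^ n) - fps_X * ((1 - fps_X ^ n) * E (c - a)
    - (1 - fps_X ^ n) * E (c - b) - (1 - fps_X ^ n) * E (e - a) + (1 - fps_X ^ n) * E (e - b))"
    by (simp add: algebra_simps)
  then show ?thesis
    unfolding prog_fps_mult[OF n_pos]
    by (simp add: rev_charpoly_def fps_of_poly_add fps_of_poly_diff fps_of_poly_mult fps_of_poly_monom')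
qed

lemma G_rec:
  "G m q = of_bool (\<phi> m = \<phi> q) + fps_X * (G m (q + 1) +
     (G m a - G m b) * (of_bool (\<phi> q = \<phi> c) - of_bool (\<phi> q = \<phi> e)))"
proof (rule fps_ext)
  fix k
  let ?z = "of_bool (\<phi> q = \<phi> c) - of_bool (\<phi> q = \<phi> e) :: int"
  show "G m q $ k = (of_bool (\<phi> m = \<phi> q) + fps_X * (G m (q + 1) +
     (G m a - G m b) * (of_bool (\<phi> q = \<phi> c) - of_bool (\<phi> q = \<phi> e)))) $ k"
  proof (cases k)
    case 0
    then show ?thesis using carrier by (simp add: G_def)
  next
    case (Suc l)
    let ?B = "A ^\<^sub>m l"
    have B: "?B \<in> carrier_mat n n" using carrier by simp
    have "(A ^\<^sub>m k) $$ (\<phi> m, \<phi> q) = (\<Sum>i<n. ?B $$ (\<phi> m, i) * A $$ (i, \<phi> q))"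
      using Suc carrier B by (simp add: scalar_prod_def lessThan_atLeast0)
    also have "\<dots> = (\<Sum>i<n. (if i = \<phi> (q + 1) then ?B $$ (\<phi> m, i) else 0)
        + ((if i = \<phi> a then ?B $$ (\<phi> m, i) * ?z else 0) - (if i = \<phi> b then ?B $$ (\<phi> m, i) * ?z else 0)))"
      by (intro sum.cong refl) (simp add: entry algebra_simps)
    also have "\<dots> = ?B $$ (\<phi> m, \<phi> (q + 1)) + (?B $$ (\<phi> m, \<phi> a) * ?z - ?B $$ (\<phi> m, \<phi> b) * ?z)"
      by (simp add: sum.distrib sum_subtractf sum.delta)
    also have "\<dots> = ?B $$ (\<phi> m, \<phi> (q + 1)) + (?B $$ (\<phi> m, \<phi> a) - ?B $$ (\<phi> m, \<phi> b)) * ?z"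
      by (simp add: algebra_simps)
    finally show ?thesis using Suc by (simp add: G_def)
  qed
qed

lemma E_rec: "E (x - q) = of_bool (\<phi> q = \<phi> x) + fps_X * E (x - (q + 1))"
proof -
  have "[x - q = 0] (mod int n) \<longleftrightarrow> \<phi> q = \<phi> x"
    by (metis label_eq cong_diff_iff_cong_0 cong_sym_eq)
  then show ?thesis using prog_fps_rec[of n "x - q"] by (simp add: algebra_simps)
qed

text \<open>The identity (1 - z A)^(-1) = (1 - z S)^(-1) + z (1 - z A)^(-1) u v^T (1 - z S)^(-1),
  with S the cyclic shift. Both sides obey the recursion \<open>G_rec\<close> in the column
  label.\<close>

lemma G_eq: "G m q = E (m - q) + fps_X * (G m a - G m b) * V q"
proof -
  define Y where "Y q = G m q - (E (m - q) + fps_X * (G m a - G m b) * V q)" for q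
  have step: "Y q = fps_X * Y (q + 1)" for q
    unfolding Y_def by (subst G_rec, subst (1 2 3) E_rec) (auto simp: algebra_simps of_bool_def)
  \<comment> \<open>Each use of \<open>step\<close> lowers the index of the coefficient by one at
    the cost of another label, until the factor z leaves constant coefficient 0.\<close>
  have "Y q $ k = 0" for k q
    by (induction k arbitrary: q) (subst step, simp)+
  then have "Y q = 0" by (simp add: fps_eq_iff)
  then show ?thesis by (simp add: Y_def)
qed

text \<open>Subtract \<open>G_eq\<close> at q = b from \<open>G_eq\<close> at q = a; the difference
  of the two values of V is s.\<close>

lemma G_left: "(1 - fps_X * s) * (G m a - G m b) = U m"
proof -
  have "G m a - G m b = U m + fps_X * (G m a - G m b) * s"
    by (subst (1) G_eq, subst (3) G_eq) (simp add: algebra_simps)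
  then show ?thesis by (simp add: algebra_simps)
qed

text \<open>The scalar v^T (1 - z A)^(-1) u, the counterpart of s for A; it supplies the inverse of
  1 - z s.\<close>

definition \<tau> :: "complex fps" where
  "\<tau> = (G c a - G c b) - (G e a - G e b)"

lemma inverse_series: "(1 - fps_X * s) * (1 + fps_X * \<tau>) = 1"
proof -
  have "(1 - fps_X * s) * (1 + fps_X * \<tau>) = (1 - fps_X * s) +
      fps_X * ((1 - fps_X * s) * (G c a - G c b) - (1 - fps_X * s) * (G e a - G e b))"
    by (simp add: \<tau>_def algebra_simps)
  also have "\<dots> = 1" unfolding G_left by (simp add: algebra_simps)
  finally show ?thesis .
qed

lemma G_right: "G c q - G e q = (1 + fps_X * \<tau>) * V q"
  by (subst G_eq, subst (2) G_eq) (simp add: \<tau>_def algebra_simps)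

lemma one_minus_X_power_neq_0: "1 - fps_X ^ n \<noteq> (0 :: complex fps)"
proof
  assume "1 - fps_X ^ n = (0 :: complex fps)"
  then have "(1 - fps_X ^ n :: complex fps) $ 0 = 0 $ 0" by (rule arg_cong)
  then show False using n_pos by (simp add: fps_X_power_nth)
qed

lemma rev_charpoly_left: "fps_of_poly rev_charpoly * (G m a - G m b) = fps_of_poly (R (m - a) - R (m - b))"
proof -
  have "fps_of_poly rev_charpoly * (G m a - G m b) = (1 - fps_X ^ n) * U m"
    using G_left[of m] unfolding fps_rev_charpoly by (simp add: mult.assoc)
  then show ?thesis by (simp add: right_diff_distrib prog_fps_mult[OF n_pos] fps_of_poly_diff)
qed

lemma rev_charpoly_right: "fps_of_poly rev_charpoly * (G c q - G e q) = fps_of_poly (R (c - q) - R (e - q))"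
proof -
  have "fps_of_poly rev_charpoly * (G c q - G e q) = (1 - fps_X ^ n) * V q"
    unfolding fps_rev_charpoly G_right using inverse_series
    by (metis (no_types, lifting) mult.assoc mult_1)
  then show ?thesis by (simp add: right_diff_distrib prog_fps_mult[OF n_pos] fps_of_poly_diff)
qed

section \<open>Divisibility forced by A^N = 1\<close>

lemma G_periodic_poly:
  assumes "A ^\<^sub>m N = 1\<^sub>m n"
  shows "\<exists>p. (1 - fps_X ^ N) * G m q = fps_of_poly p"
proof (rule periodic_fps_poly)
  fix k
  have "A ^\<^sub>m (k + N) = A ^\<^sub>m k"
    using assms carrier by (simp add: pow_mat_add_exponent)
  then show "G m q $ (k + N) = G m q $ k" by (simp add: G_def)
qed

lemma rev_charpoly_dvd:
  assumes "A ^\<^sub>m N = 1\<^sub>m n"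
  shows "rev_charpoly dvd (1 - monom 1 n) * (1 - monom 1 N)"
proof -
  obtain p1 p2 p3 p4 where p: "(1 - fps_X ^ N) * G c a = fps_of_poly p1"
    "(1 - fps_X ^ N) * G c b = fps_of_poly p2" "(1 - fps_X ^ N) * G e a = fps_of_poly p3"
    "(1 - fps_X ^ N) * G e b = fps_of_poly p4" using G_periodic_poly[OF assms] by metis
  \<comment> \<open>This polynomial is (1 - z^N) (1 + z \<tau>). In its product with F = (1 - z^n)
    (1 - z s) the mutually inverse factors disappear.\<close>
  let ?p = "(1 - monom 1 N) + monom 1 1 * (p1 - p2 - (p3 - p4))"
  have 1: "fps_of_poly ?p = (1 - fps_X ^ N) * (1 + fps_X * \<tau>)"
    unfolding \<tau>_def fps_of_poly_add fps_of_poly_mult fps_of_poly_diff p[symmetric] fps_of_poly_monom'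
    by (simp add: algebra_simps)
  have "fps_of_poly (rev_charpoly * ?p) = fps_of_poly ((1 - monom 1 n) * (1 - monom 1 N))"
    unfolding fps_of_poly_mult 1 fps_rev_charpoly fps_of_poly_diff fps_of_poly_monom' fps_of_poly_1
    by (metis (no_types, lifting) inverse_series mult.assoc mult.left_commute mult_1_right)
  then show ?thesis unfolding fps_of_poly_eq_iff by (metis dvd_triv_left)
qed

section \<open>Adjugate entries and a sufficient condition for A^L = 1\<close>

lemma residue_monom_mult_swap:
  assumes "r1 + r2 = r3 + r4"
  shows "\<exists>g. R r1 * R r2 - R r3 * R r4 = (1 - monom 1 n) * g \<and> degree g + 1 < n"
proof -
  define i k where "i = nat (r1 mod int n) + nat (r2 mod int n)"
    and "k = nat (r3 mod int n) + nat (r4 mod int n)"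
  have bounds: "nat (r mod int n) < n" for r using n_pos by (simp add: nat_less_iff)
  have ik: "i + 1 < 2 * n" "k + 1 < 2 * n"
    using bounds[of r1] bounds[of r2] bounds[of r3] bounds[of r4] by (auto simp: i_def k_def)
  have "int i mod int n = int k mod int n"
    using assms n_pos by (simp add: i_def k_def mod_add_eq)
  then have "i mod n = k mod n" by (metis of_nat_eq_iff zmod_int)
  moreover have "x mod n = (if x < n then x else x - n)" if "x + 1 < 2 * n" for x
    using that by (auto simp: le_mod_geq)
  \<comment> \<open>The two exponents are congruent modulo \<open>n\<close> and below 2 n - 1, so
    they agree or differ by exactly \<open>n\<close>; in the latter case the smaller one is below n
    - 1.\<close>
  ultimately consider "i = k" "n = 1" | "i = k" "n > 1" | "k = i + n" "n > 1" | "i = k + n" "n > 1"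
    using ik n_pos by (fastforce split: if_splits)
  then show ?thesis
  proof cases
    case 1
    then show ?thesis using n_gt_1 by simp
  next
    case 2
    then show ?thesis by (intro exI[of _ 0]) (simp add: mult_monom i_def k_def)
  next
    case 3
    then have "i + 1 < n" using ik by simp
    with 3 show ?thesis
      by (intro exI[of _ "monom 1 i"])
         (simp add: mult_monom left_diff_distrib degree_monom_eq add.commute flip: i_def k_def)
  next
    case 4
    then have "k + 1 < n" using ik by simp
    with 4 show ?thesis
      by (intro exI[of _ "- monom 1 k"])
         (simp add: mult_monom left_diff_distrib degree_monom_eq algebra_simps flip: i_def k_def)
  qed
qed

end

text \<open>Here d stands for 1 - z^n, x for z, and a two-letter variable for the residue monomial
  of a difference of labels. The brackets on the right are 2 x 2 minors, divisible by 1 - z^n by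
  \<open>residue_monom_mult_swap\<close>. Abstract variables keep the monomials from being
  multiplied out.\<close>

lemma adjugate_expand:
  fixes d x ca cb ea eb ma mb cq eq mq g1 g2 g3 g4 :: "'a :: comm_ring_1"
  shows "(d - x * (ca - cb - ea + eb)) * mq + (ma - mb) * x * (cq - eq) =
    d * mq + x * ((ma * cq - ca * mq) - (mb * cq - cb * mq) - (ma * eq - ea * mq) + (mb * eq - eb * mq))"
  by (simp add: algebra_simps)

lemma adjugate_factor:
  fixes d x ca cb ea eb ma mb cq eq mq g1 g2 g3 g4 :: "'a :: comm_ring_1"
  shows "d * mq + x * (d * g1 - d * g2 - d * g3 + d * g4) = d * (mq + x * (g1 - g2 - g3 + g4))"
  by (simp add: algebra_simps)

context labelled_PT begin

text \<open>F times the resolvent is the adjugate of 1 - z A. The resolvent identity directly gives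
  only the denominator (1 - z^n) F; the factor 1 - z^n cancels because it divides all four minors in
  the numerator.\<close>

lemma rev_charpoly_G: "\<exists>P. fps_of_poly rev_charpoly * G m q = fps_of_poly P \<and> degree P < n"
proof -
  obtain g1 where g1: "R (m - a) * R (c - q) - R (c - a) * R (m - q) = (1 - monom 1 n) * g1" "degree g1 + 1 < n"
    using residue_monom_mult_swap[of "m - a" "c - q" "c - a" "m - q"] by auto
  obtain g2 where g2: "R (m - b) * R (c - q) - R (c - b) * R (m - q) = (1 - monom 1 n) * g2" "degree g2 + 1 < n"
    using residue_monom_mult_swap[of "m - b" "c - q" "c - b" "m - q"] by auto
  obtain g3 where g3: "R (m - a) * R (e - q) - R (e - a) * R (m - q) = (1 - monom 1 n) * g3" "degree g3 + 1 < n"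
    using residue_monom_mult_swap[of "m - a" "e - q" "e - a" "m - q"] by auto
  obtain g4 where g4: "R (m - b) * R (e - q) - R (e - b) * R (m - q) = (1 - monom 1 n) * g4" "degree g4 + 1 < n"
    using residue_monom_mult_swap[of "m - b" "e - q" "e - b" "m - q"] by auto
  define P where "P = R (m - q) + monom 1 1 * (g1 - g2 - g3 + g4)"
  let ?D = "1 - fps_X ^ n :: complex fps"
  have D: "fps_of_poly (1 - monom 1 n) = ?D"
    by (simp add: fps_of_poly_diff fps_of_poly_monom')
  have VD: "?D * V q = fps_of_poly (R (c - q) - R (e - q))"
    by (simp add: right_diff_distrib prog_fps_mult[OF n_pos] fps_of_poly_diff)
  have "?D * (fps_of_poly rev_charpoly * G m q) =
      fps_of_poly rev_charpoly * (?D * E (m - q)) + fps_of_poly rev_charpoly * (G m a - G m b) * fps_X * (?D * V q)"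
    by (subst G_eq) (simp add: algebra_simps)
  also have "\<dots> = fps_of_poly (rev_charpoly * R (m - q) + (R (m - a) - R (m - b)) * monom 1 1 * (R (c - q) - R (e - q)))"
    unfolding VD rev_charpoly_left prog_fps_mult[OF n_pos]
    by (simp only: fps_of_poly_add fps_of_poly_mult fps_of_poly_monom' power_one_right)
  also have "rev_charpoly * R (m - q) + (R (m - a) - R (m - b)) * monom 1 1 * (R (c - q) - R (e - q)) =
      (1 - monom 1 n) * R (m - q) + monom 1 1 *
      ((R (m - a) * R (c - q) - R (c - a) * R (m - q)) - (R (m - b) * R (c - q) - R (c - b) * R (m - q))
       - (R (m - a) * R (e - q) - R (e - a) * R (m - q)) + (R (m - b) * R (e - q) - R (e - b) * R (m - q)))"
    unfolding rev_charpoly_def by (rule adjugate_expand)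
  also have "\<dots> = (1 - monom 1 n) * P"
    unfolding g1 g2 g3 g4 P_def by (rule adjugate_factor)
  finally have "?D * (fps_of_poly rev_charpoly * G m q) = ?D * fps_of_poly P"
    by (simp only: fps_of_poly_mult D)
  then have "fps_of_poly rev_charpoly * G m q = fps_of_poly P"
    using one_minus_X_power_neq_0 by simp
  moreover have "degree P < n"
  proof -
    have "nat ((m - q) mod int n) < n" using n_pos by (simp add: nat_less_iff)
    then have 1: "degree (R (m - q)) < n" by (simp add: degree_monom_eq)
    have "degree (g1 - g2 - g3 + g4) < n - 1"
      using g1(2) g2(2) g3(2) g4(2) by (intro degree_add_less degree_diff_less) auto
    then have "degree (monom 1 1 * (g1 - g2 - g3 + g4)) < n"
      using degree_mult_le[of "monom (1::complex) 1" "g1 - g2 - g3 + g4"]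
      by (simp add: degree_monom_eq)
    with 1 show ?thesis unfolding P_def by (rule degree_add_less)
  qed
  ultimately show ?thesis by blast
qed

text \<open>If 1 - z^L = F H, then (1 - z^L) G is H times an adjugate entry and has degree below L.
  The vanishing coefficient at L says that A^L and A^0 agree.\<close>

lemma power_eq_1:
  assumes "rev_charpoly dvd 1 - monom 1 L" "degree rev_charpoly = n" "L > 0"
  shows "A ^\<^sub>m L = 1\<^sub>m n"
proof -
  obtain H where H: "1 - monom 1 L = rev_charpoly * H" using assms(1) by (elim dvdE)
  have "coeff (1 - monom 1 L :: complex poly) L \<noteq> 0" using assms(3) by simp
  then have nz: "1 - monom 1 L \<noteq> (0 :: complex poly)" by (metis coeff_0)
  have "L \<le> degree (1 - monom 1 L :: complex poly)"
    by (rule le_degree) fact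
  moreover have "degree (1 - monom 1 L :: complex poly) \<le> L"
    by (intro degree_diff_le) (simp_all add: degree_monom_le)
  ultimately have "degree (rev_charpoly * H) = L" using H by simp
  then have degH: "n + degree H = L"
    using H nz assms(2) by (simp add: degree_mult_eq)
  have "G m q $ L = G m q $ 0" for m q
  proof -
    obtain P where P: "fps_of_poly rev_charpoly * G m q = fps_of_poly P" "degree P < n"
      using rev_charpoly_G by blast
    have "(1 - fps_X ^ L) * G m q = fps_of_poly (H * P)"
    proof -
      have "1 - fps_X ^ L = fps_of_poly rev_charpoly * fps_of_poly H"
        by (simp add: fps_of_poly_diff fps_of_poly_monom' flip: fps_of_poly_mult H)
      then have "(1 - fps_X ^ L) * G m q = fps_of_poly H * (fps_of_poly rev_charpoly * G m q)"
        by (simp only: mult_ac)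
      then show ?thesis by (simp only: P(1) fps_of_poly_mult)
    qed
    moreover have "coeff (H * P) L = 0"
      using degree_mult_le[of H P] P(2) degH by (intro coeff_eq_0) linarith
    ultimately have "((1 - fps_X ^ L) * G m q) $ L = 0" by simp
    then show ?thesis using assms(3) by (simp add: left_diff_distrib fps_X_power_mult_nth)
  qed
  then have eq: "(A ^\<^sub>m L) $$ (\<phi> m, \<phi> q) = (A ^\<^sub>m 0) $$ (\<phi> m, \<phi> q)" for m q
    unfolding G_def fps_nth_Abs_fps of_int_eq_iff .
  have "(A ^\<^sub>m L) $$ (i, k) = (A ^\<^sub>m 0) $$ (i, k)" if "i < n" "k < n" for i k
  proof -
    have "i \<in> range \<phi>" "k \<in> range \<phi>" using that range by auto
    then show ?thesis using eq by blast
  qed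
  then show ?thesis using carrier by (intro eq_matI) auto
qed

text \<open>Multiplied by 1 - z^k, the left side of \<open>rev_charpoly_left\<close> is F times a
  polynomial and vanishes at \<zeta>. As 1 - \<zeta>^k is nonzero, the numerator on the right
  vanishes at \<zeta>.\<close>

lemma rev_charpoly_root_left:
  assumes "A ^\<^sub>m k = 1\<^sub>m n" "poly rev_charpoly \<zeta> = 0" "\<zeta> ^ k \<noteq> 1"
  shows "\<zeta> ^ nat ((m - a) mod int n) = \<zeta> ^ nat ((m - b) mod int n)"
proof -
  obtain p1 p2 where p: "(1 - fps_X ^ k) * G m a = fps_of_poly p1" "(1 - fps_X ^ k) * G m b = fps_of_poly p2"
    using G_periodic_poly[OF assms(1)] by metis
  have "fps_of_poly (rev_charpoly * (p1 - p2)) = (1 - fps_X ^ k) * (fps_of_poly rev_charpoly * (G m a - G m b))"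
    by (simp add: fps_of_poly_mult fps_of_poly_diff algebra_simps flip: p)
  also have "\<dots> = fps_of_poly ((1 - monom 1 k) * (R (m - a) - R (m - b)))"
    unfolding rev_charpoly_left by (simp add: fps_of_poly_mult fps_of_poly_diff fps_of_poly_monom')
  finally have "rev_charpoly * (p1 - p2) = (1 - monom 1 k) * (R (m - a) - R (m - b))"
    by (simp only: fps_of_poly_eq_iff)
  then have "poly (rev_charpoly * (p1 - p2)) \<zeta> = poly ((1 - monom 1 k) * (R (m - a) - R (m - b))) \<zeta>" by simp
  then show ?thesis using assms(2,3) by (simp add: poly_monom)
qed

lemma rev_charpoly_root_right:
  assumes "A ^\<^sub>m k = 1\<^sub>m n" "poly rev_charpoly \<zeta> = 0" "\<zeta> ^ k \<noteq> 1"
  shows "\<zeta> ^ nat ((c - q) mod int n) = \<zeta> ^ nat ((e - q) mod int n)"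
proof -
  obtain p1 p2 where p: "(1 - fps_X ^ k) * G c q = fps_of_poly p1" "(1 - fps_X ^ k) * G e q = fps_of_poly p2"
    using G_periodic_poly[OF assms(1)] by metis
  have "fps_of_poly (rev_charpoly * (p1 - p2)) = (1 - fps_X ^ k) * (fps_of_poly rev_charpoly * (G c q - G e q))"
    by (simp add: fps_of_poly_mult fps_of_poly_diff algebra_simps flip: p)
  also have "\<dots> = fps_of_poly ((1 - monom 1 k) * (R (c - q) - R (e - q)))"
    unfolding rev_charpoly_right by (simp add: fps_of_poly_mult fps_of_poly_diff fps_of_poly_monom')
  finally have "rev_charpoly * (p1 - p2) = (1 - monom 1 k) * (R (c - q) - R (e - q))"
    by (simp only: fps_of_poly_eq_iff)
  then have "poly (rev_charpoly * (p1 - p2)) \<zeta> = poly ((1 - monom 1 k) * (R (c - q) - R (e - q))) \<zeta>" by simp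
  then show ?thesis using assms(2,3) by (simp add: poly_monom)
qed

section \<open>The exponents of the reversed characteristic polynomial\<close>

definition gap :: "int \<Rightarrow> int \<Rightarrow> nat" where
  "gap x y = Suc (nat ((x - y) mod int n))"

text \<open>The successor in \<open>gap\<close> absorbs the factor z in front of the residue
  monomials.\<close>

lemma rev_charpoly_gap:
  "rev_charpoly = 1 - monom 1 n - monom 1 (gap c a) + monom 1 (gap c b) + monom 1 (gap e a) - monom 1 (gap e b)"
  unfolding rev_charpoly_def gap_def by (simp add: algebra_simps mult_monom)

lemma gap_pos: "gap x y > 0"
  by (simp add: gap_def)

text \<open>The value \<open>n\<close> would need x - y congruent to -1, that is, a 1 of the
  permutation part in row y and column x.\<close>

lemma gap_less: "\<phi> (x + 1) \<noteq> \<phi> y \<Longrightarrow> gap x y < n"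
proof -
  assume "\<phi> (x + 1) \<noteq> \<phi> y"
  then have "\<not> [x + 1 = y] (mod int n)" by (simp add: label_eq)
  then have "(x - y) mod int n \<noteq> int n - 1"
    by (metis add.commute add_diff_cancel_left' cong_add_rcancel cong_def cong_diff_iff_cong_0 diff_add_cancel
        diff_add_eq mod_add_left_eq mod_self)
  moreover have "(x - y) mod int n < int n" "(x - y) mod int n \<ge> 0" using n_pos by auto
  ultimately show ?thesis unfolding gap_def by linarith
qed

lemma gap_cong: "[int (gap x y) = x - y + 1] (mod int n)"
proof -
  have "int (gap x y) = (x - y) mod int n + 1" using n_pos by (simp add: gap_def)
  then show ?thesis by (simp add: cong_def mod_add_left_eq)
qed

lemma gap_eq_iff1: "gap x y = gap x z \<longleftrightarrow> \<phi> y = \<phi> z"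
  using n_pos by (auto simp: gap_def label_eq cong_def eq_nat_nat_iff mod_eq_dvd_iff dvd_diff_commute)

lemma gap_eq_iff2: "gap y x = gap z x \<longleftrightarrow> \<phi> y = \<phi> z"
  using n_pos by (simp add: gap_def label_eq cong_def eq_nat_nat_iff mod_eq_dvd_iff)

lemma gap_eqI:
  assumes "[int k = x - y + 1] (mod int n)" "0 < k" "k \<le> n"
  shows "gap x y = k"
proof -
  have "int k - 1 = (x - y) mod int n"
  proof -
    have "[int k - 1 = x - y] (mod int n)"
      using cong_diff[OF assms(1) cong_refl[of 1]] by simp
    then show ?thesis using assms(2,3) by (simp add: cong_def)
  qed
  then show ?thesis using assms(2) by (simp add: gap_def)
qed

end

section \<open>Roots of unity\<close>

text \<open>The root is primitive: its powers with exponents below N are distinct, and k may be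
  reduced modulo N.\<close>

lemma cis_root_power_eq_1_iff:
  assumes "N > 0"
  shows "cis (2 * pi / real N) ^ k = 1 \<longleftrightarrow> N dvd k"
proof -
  let ?\<zeta> = "cis (2 * pi / real N)"
  have inj: "inj_on (\<lambda>k. cis (2 * pi * real k / real N)) {..<N}"
    using bij_betw_roots_unity[OF assms] by (rule bij_betw_imp_inj_on)
  have pow: "?\<zeta> ^ l = cis (2 * pi * real l / real N)" for l
    by (simp add: DeMoivre algebra_simps)
  have N: "?\<zeta> ^ N = 1" using assms by (simp add: pow)
  have "?\<zeta> ^ k = ?\<zeta> ^ (N * (k div N) + k mod N)" by simp
  also have "\<dots> = ?\<zeta> ^ (k mod N)" by (simp only: power_add power_mult N) simp
  finally have "?\<zeta> ^ k = 1 \<longleftrightarrow> ?\<zeta> ^ (k mod N) = ?\<zeta> ^ 0" by simp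
  also have "\<dots> \<longleftrightarrow> k mod N = 0"
    using inj_onD[OF inj, of "k mod N" 0] assms by (auto simp: pow)
  finally show ?thesis by (simp add: dvd_eq_mod_eq_0)
qed

lemma cis_half_power:
  assumes "m > 0"
  shows "cis (2 * pi / real (2 * m)) ^ m = -1"
  using assms by (simp add: DeMoivre)

text \<open>If j had the smaller 2-part, some odd multiple of m would be an even multiple of j, and
  this power of \<zeta> would be both -1 and 1.\<close>

lemma common_root_minus_1_le:
  fixes \<zeta> :: complex
  assumes "\<zeta> ^ j = -1" "\<zeta> ^ m = -1" "j > 0" "m > 0"
  shows "multiplicity 2 j \<ge> multiplicity 2 m"
proof (rule ccontr)
  assume "\<not> ?thesis"
  then have lt: "multiplicity 2 j < multiplicity 2 m" by simp
  obtain j' where j: "j = 2 ^ multiplicity 2 j * j'" "odd j'"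
    using assms(3) multiplicity_decompose'[of j "2::nat"] by auto
  obtain m' where m: "m = 2 ^ multiplicity 2 m * m'" "odd m'"
    using assms(4) multiplicity_decompose'[of m "2::nat"] by auto
  let ?d = "multiplicity 2 m - multiplicity 2 j"
  have "(2::nat) ^ multiplicity 2 m = 2 ^ multiplicity 2 j * 2 ^ ?d"
    using lt by (simp flip: power_add)
  then have "m * j' = (2 ^ multiplicity 2 j * j') * (2 ^ ?d * m')" by (subst m(1)) simp
  then have "m * j' = j * (2 ^ ?d * m')" by (simp only: flip: j(1))
  moreover have "even (2 ^ ?d * m')" using lt by simp
  ultimately have "(\<zeta> ^ m) ^ j' = 1"
    using assms(1) by (metis power_mult uminus_power_if power_one)
  then show False using assms(2) j(2) by simp
qed

lemma common_root_minus_1: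
  fixes \<zeta> :: complex
  assumes "\<zeta> ^ j = -1" "\<zeta> ^ m = -1" "j > 0" "m > 0"
  shows "two_part j = two_part m"
  using common_root_minus_1_le[OF assms] common_root_minus_1_le[OF assms(2,1,4,3)]
  by (simp add: two_part_def)

lemma common_root_minus_1_exists:
  assumes "two_part j = two_part m" "j > 0" "m > 0"
  obtains \<zeta> :: complex where "\<zeta> ^ j = -1" "\<zeta> ^ m = -1"
proof -
  \<comment> \<open>A primitive root of twice the common 2-part: raised to the 2-part it gives -1,
    and the remaining odd cofactor preserves -1.\<close>
  let ?\<zeta> = "cis (2 * pi / real (2 * two_part j))"
  have "?\<zeta> ^ k = -1" if tp: "two_part k = two_part j" "k > 0" for k
  proof -
    obtain k' where k': "k = 2 ^ multiplicity 2 k * k'" "odd k'"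
      using tp(2) multiplicity_decompose'[of k "2::nat"] by auto
    have k: "k = two_part j * k'" using k'(1) tp(1) by (simp add: two_part_def)
    have "?\<zeta> ^ k = (?\<zeta> ^ two_part j) ^ k'" by (subst k(1)) (simp only: power_mult)
    also have "?\<zeta> ^ two_part j = -1" by (rule cis_half_power) (simp add: two_part_def)
    finally show ?thesis using k'(2) by simp
  qed
  with assms show ?thesis by (intro that[of ?\<zeta>]) auto
qed

section \<open>Multiplicities of roots\<close>

lemma order_one_minus_monom_le:
  fixes \<zeta> :: complex
  assumes "m > 0"
  shows "order \<zeta> (1 - monom 1 m) \<le> 1"
proof (rule ccontr)
  assume "\<not> ?thesis"
  then have "[:-\<zeta>, 1:] ^ 2 dvd 1 - monom 1 m" by (simp add: order_divides)
  then obtain h where h: "1 - monom 1 m = [:-\<zeta>, 1:] ^ 2 * h" by (elim dvdE)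
  then have "poly (1 - monom 1 m) \<zeta> = 0" by simp
  then have root: "\<zeta> ^ m = 1" by (simp add: poly_monom)
  \<comment> \<open>A double root would also be a root of the derivative - m z^(m - 1), hence 0
    whenever m > 1, while \<zeta>^m = 1.\<close>
  have "pderiv (1 - monom 1 m) = [:-\<zeta>, 1:] * (2 * h + [:-\<zeta>, 1:] * pderiv h)"
  proof -
    define q where "q = [:-\<zeta>, 1:]"
    have "pderiv q = 1" by (simp add: q_def pderiv_pCons)
    then have "pderiv (q ^ 2 * h) = q * (2 * h + q * pderiv h)"
      by (simp add: pderiv_mult power2_eq_square algebra_simps)
    then show ?thesis unfolding h q_def .
  qed
  then have "poly (pderiv (1 - monom 1 m)) \<zeta> = 0" by simp
  then have "\<zeta> ^ (m - 1) = 0" using assms by (simp add: pderiv_diff pderiv_monom poly_monom)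
  then show False using root assms by (simp add: power_0_left)
qed

lemma one_minus_monom_neq_0:
  assumes "m > 0"
  shows "1 - monom 1 m \<noteq> (0 :: complex poly)"
proof
  assume "1 - monom 1 m = (0 :: complex poly)"
  then have "poly (1 - monom 1 m) 0 = (0 :: complex)" by simp
  with assms show False by (simp add: poly_monom power_0_left)
qed

lemma no_triple_root:
  fixes \<zeta> :: complex
  assumes "p dvd (1 - monom 1 k) * (1 - monom 1 l)" "k > 0" "l > 0"
  shows "\<not> [:-\<zeta>, 1:] ^ 3 dvd p"
proof
  assume "[:-\<zeta>, 1:] ^ 3 dvd p"
  then have "[:-\<zeta>, 1:] ^ 3 dvd (1 - monom 1 k) * (1 - monom 1 l)" using assms(1) dvd_trans by blast
  moreover have nz: "(1 - monom 1 k) * (1 - monom 1 l) \<noteq> (0 :: complex poly)"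
    using assms one_minus_monom_neq_0 by simp
  ultimately have "3 \<le> order \<zeta> ((1 - monom 1 k) * (1 - monom 1 l))" by (simp add: order_divides)
  also have "\<dots> = order \<zeta> (1 - monom 1 k) + order \<zeta> (1 - monom 1 l)" by (rule order_mult[OF nz])
  also have "\<dots> \<le> 2"
    using order_one_minus_monom_le[OF assms(2), of \<zeta>] order_one_minus_monom_le[OF assms(3), of \<zeta>] by simp
  finally show False by simp
qed

lemma three_roots_dvd:
  fixes \<zeta> :: complex
  assumes "poly p \<zeta> = 0" "poly q \<zeta> = 0" "poly r \<zeta> = 0"
  shows "[:-\<zeta>, 1:] ^ 3 dvd p * q * r"
  unfolding power3_eq_cube using assms by (intro mult_dvd_mono) (simp_all only: poly_eq_0_iff_dvd)

section \<open>Polynomials with all roots on the unit circle\<close>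

lemma map_poly_cnj_mult: "map_poly cnj (p * q) = map_poly cnj p * map_poly cnj q"
  by (simp add: poly_eq_poly_eq_iff[symmetric] fun_eq_iff)

text \<open>For |x| = 1 the reflection 1 - x z of z - x equals -x (z - cnj x), since the inverse of
  x is its conjugate.\<close>

lemma reflect_prod_unimodular:
  assumes "\<And>x. x \<in># M \<Longrightarrow> cmod x = 1"
  shows "\<exists>k. reflect_poly (\<Prod>x\<in>#M. [:-x, 1:]) = smult k (map_poly cnj (\<Prod>x\<in>#M. [:-x, 1:]))"
  using assms
proof (induction M)
  case empty
  show ?case by (intro exI[of _ 1]) simp
next
  case (add x M)
  then obtain k where k: "reflect_poly (\<Prod>x\<in>#M. [:-x, 1:]) = smult k (map_poly cnj (\<Prod>x\<in>#M. [:-x, 1:]))"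
    by auto
  have x: "x * cnj x = 1" using add.prems[of x] by (simp add: complex_norm_square[symmetric])
  then have "x \<noteq> 0" by auto
  then have "reflect_poly [:-x, 1:] = smult (-x) (map_poly cnj [:-x, 1:])"
    using x by (simp add: reflect_poly_pCons map_poly_pCons cCons_def)
  then show ?case
    by (intro exI[of _ "k * -x"])
       (simp only: reflect_poly_mult map_poly_cnj_mult k image_mset_add_mset prod_mset.add_mset
          mult_smult_left mult_smult_right smult_smult mult_ac)
qed

text \<open>Reflecting the linear factors yields the conjugate polynomial up to a scalar, and
  conjugation fixes p because its coefficients are real.\<close>

lemma reflect_poly_unimodular:
  fixes p :: "complex poly"
  assumes "p \<noteq> 0" "\<And>x. poly p x = 0 \<Longrightarrow> cmod x = 1" "map_poly cnj p = p"
  shows "\<exists>k. reflect_poly p = smult k p"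
proof -
  let ?q = "\<Prod>x\<in>#proots p. [:-x, 1:]"
  have dec: "p = smult (lead_coeff p) ?q" by (rule complex_poly_decompose_multiset[symmetric])
  obtain k where k: "reflect_poly ?q = smult k (map_poly cnj ?q)"
    using reflect_prod_unimodular[of "proots p"] assms(1,2) by auto
  have "?q = smult (1 / lead_coeff p) p" using assms(1) by (subst (2) dec) simp
  then have "map_poly cnj ?q = smult (cnj (1 / lead_coeff p)) p"
    using assms(3) by (simp add: map_poly_smult)
  then have "reflect_poly p = smult (lead_coeff p * (k * cnj (1 / lead_coeff p))) p"
    by (subst dec) (simp only: reflect_poly_smult k smult_smult)
  then show ?thesis by blast
qed

section \<open>Divisibility of complex polynomials\<close>

lemma coprime_complex_polyI:
  fixes p q :: "complex poly"
  assumes "p \<noteq> 0" "\<And>x. poly p x = 0 \<Longrightarrow> poly q x \<noteq> 0"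
  shows "coprime p q"
proof (rule coprimeI)
  fix r assume r: "r dvd p" "r dvd q"
  then have "r \<noteq> 0" using assms(1) by auto
  have "degree r = 0"
  proof (rule ccontr)
    assume "degree r \<noteq> 0"
    then obtain x where "poly r x = 0"
      using fundamental_theorem_of_algebra[of r] by (auto simp: constant_degree)
    then show False using r assms(2)[of x] by (meson dvd_trans poly_eq_0_iff_dvd)
  qed
  with \<open>r \<noteq> 0\<close> show "is_unit r" by (simp add: is_unit_iff_degree)
qed

lemma one_minus_monom_dvd:
  assumes "k dvd l"
  shows "1 - monom 1 k dvd (1 - monom 1 l :: complex poly)"
proof -
  obtain t where "l = k * t" using assms by (elim dvdE)
  then have "monom 1 l = (monom 1 k :: complex poly) ^ t" by (simp add: monom_power)
  moreover have "1 - monom 1 k dvd (1 :: complex poly) ^ t - monom 1 k ^ t"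
    unfolding power_diff_sumr2 by (rule dvd_triv_left)
  ultimately show ?thesis by simp
qed

section \<open>Finite order determines the exponents\<close>

text \<open>The exponents q1, q4 carry coefficient -1 and q2, q3 carry +1, so reflection must send
  each exponent to one of opposite sign. Coincidences q1 = q4 and q2 = q3 remain possible.\<close>

lemma antisymmetric_exponents:
  fixes q1 q2 q3 q4 n :: nat
  assumes bounds: "0 < q1" "q1 < n" "0 < q2" "q2 < n" "0 < q3" "q3 < n" "0 < q4" "q4 < n"
    and ne: "q1 \<noteq> q2" "q1 \<noteq> q3" "q4 \<noteq> q2" "q4 \<noteq> q3"
    and anti: "\<And>k. 0 < k \<Longrightarrow> k < n \<Longrightarrow>
      of_bool (n - k = q2) + of_bool (n - k = q3) - of_bool (n - k = q1) - of_bool (n - k = q4) =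
      - (of_bool (k = q2) + of_bool (k = q3) - of_bool (k = q1) - of_bool (k = q4) :: complex)"
  shows "q1 + q2 = n \<and> q3 + q4 = n \<or> q1 + q3 = n \<and> q2 + q4 = n"
proof -
  have sub: "n - k = q \<longleftrightarrow> q + k = n" if "0 < k" "k < n" for k q using that by auto
  \<comment> \<open>Moving all terms to their positive sides gives an equation of naturals, in which
    no cancellation can hide an exponent.\<close>
  have anti': "of_bool (q2 + k = n) + of_bool (q3 + k = n) + of_bool (k = q2) + of_bool (k = q3) =
      of_bool (q1 + k = n) + of_bool (q4 + k = n) + of_bool (k = q1) + (of_bool (k = q4) :: nat)"
    if "0 < k" "k < n" for k
  proof -
    have "of_nat (of_bool (q2 + k = n) + of_bool (q3 + k = n) + of_bool (k = q2) + of_bool (k = q3)) =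
      (of_nat (of_bool (q1 + k = n) + of_bool (q4 + k = n) + of_bool (k = q1) + of_bool (k = q4)) :: complex)"
      using anti[OF that] unfolding sub[OF that] by (simp add: algebra_simps)
    then show ?thesis by (simp only: of_nat_eq_iff)
  qed
  have "q2 + q1 = n \<or> q3 + q1 = n"
    using anti'[of q1] bounds ne by (auto split: if_splits simp: of_bool_def)
  moreover have "q2 + q4 = n \<or> q3 + q4 = n"
    using anti'[of q4] bounds ne by (auto split: if_splits simp: of_bool_def)
  moreover have "q1 + q2 = n \<or> q4 + q2 = n"
    using anti'[of q2] bounds ne by (auto split: if_splits simp: of_bool_def)
  moreover have "q1 + q3 = n \<or> q4 + q3 = n"
    using anti'[of q3] bounds ne by (auto split: if_splits simp: of_bool_def)
  ultimately show ?thesis by linarith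
qed

text \<open>The scalar s is later 1 or -1, so both candidate factorizations of F are covered at
  once.\<close>

lemma monom_cyclotomic_product:
  fixes s :: "'a :: comm_ring_1"
  assumes "s * s = 1"
  shows "(1 + monom s j) * (1 + monom s l) * (1 - monom 1 (j + l)) =
    1 - monom 1 (2 * (j + l)) - monom s (j + 2 * l) - monom s (2 * j + l) + monom s j + monom s l"
proof -
  have "2 * (j + l) = (j + l) + (j + l)" "j + 2 * l = (j + l) + l" "2 * j + l = (j + l) + j"
    by auto
  then have e: "monom 1 (2 * (j + l)) = monom 1 (j + l) * (monom 1 (j + l) :: 'a poly)"
    "monom s (j + 2 * l) = monom 1 (j + l) * monom s l"
    "monom s (2 * j + l) = monom 1 (j + l) * monom s j"
    by (simp_all only: mult_monom) simp_all
  have f: "monom 1 (j + l) = monom s j * monom s l" using assms by (simp add: mult_monom)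
  show ?thesis unfolding e f by (simp add: ring_distribs mult_ac)
qed

context labelled_PT begin

lemma gap_bounds:
  "0 < gap c a" "gap c a < n" "0 < gap c b" "gap c b < n"
  "0 < gap e a" "gap e a < n" "0 < gap e b" "gap e b < n"
  using disjoint by (auto simp: gap_pos intro!: gap_less)

lemma gap_neqs:
  "gap c a \<noteq> gap c b" "gap c a \<noteq> gap e a" "gap e b \<noteq> gap c b" "gap e b \<noteq> gap e a"
  using rows cols by (auto simp: gap_eq_iff1 gap_eq_iff2)

lemma coeff_rev_charpoly:
  "coeff rev_charpoly k = of_bool (k = 0) - of_bool (k = n) - of_bool (k = gap c a) + of_bool (k = gap c b)
     + of_bool (k = gap e a) - of_bool (k = gap e b)"
  unfolding rev_charpoly_gap by (auto simp: coeff_1 of_bool_def)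

lemma degree_rev_charpoly: "degree rev_charpoly = n"
proof (rule antisym)
  show "degree rev_charpoly \<le> n"
    by (rule degree_le) (use gap_bounds in \<open>auto simp: coeff_rev_charpoly\<close>)
  show "n \<le> degree rev_charpoly"
    by (rule le_degree) (use gap_bounds n_pos in \<open>auto simp: coeff_rev_charpoly\<close>)
qed

lemma rev_charpoly_roots_unimodular:
  assumes "A ^\<^sub>m N = 1\<^sub>m n" "N > 0" "poly rev_charpoly x = 0"
  shows "cmod x = 1"
proof -
  have "poly ((1 - monom 1 n) * (1 - monom 1 N)) x = 0"
    using rev_charpoly_dvd[OF assms(1)] assms(3) unfolding poly_eq_0_iff_dvd by (rule dvd_trans[rotated])
  then have "x ^ n = 1 \<or> x ^ N = 1" by (simp add: poly_monom)
  then show ?thesis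
    using n_pos assms(2) power_eq_1_iff[of x n] power_eq_1_iff[of x N] by auto
qed

lemma gap_sums:
  assumes "A ^\<^sub>m N = 1\<^sub>m n" "N > 0"
  shows "gap c a + gap c b = n \<and> gap e a + gap e b = n \<or> gap c a + gap e a = n \<and> gap c b + gap e b = n"
proof -
  have nz: "rev_charpoly \<noteq> 0" using degree_rev_charpoly n_pos by auto
  have "map_poly cnj rev_charpoly = rev_charpoly"
    by (rule poly_eqI) (simp add: coeff_map_poly coeff_rev_charpoly of_bool_def)
  then obtain k where k: "reflect_poly rev_charpoly = smult k rev_charpoly"
    using reflect_poly_unimodular[OF nz] rev_charpoly_roots_unimodular[OF assms] by blast
  \<comment> \<open>Comparing constant coefficients fixes the scalar: F has leading coefficient -1
    and constant coefficient 1.\<close>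
  have "coeff rev_charpoly n = k * coeff rev_charpoly 0"
    using arg_cong[OF k, of "\<lambda>p. coeff p 0"] by (simp add: degree_rev_charpoly)
  moreover have "coeff rev_charpoly n = -1" "coeff rev_charpoly 0 = 1"
    using gap_bounds n_pos by (auto simp: coeff_rev_charpoly)
  ultimately have "k = -1" by simp
  have mirror: "coeff rev_charpoly (n - i) = - coeff rev_charpoly i" if "i < n" for i
    using arg_cong[OF k, of "\<lambda>p. coeff p i"] that \<open>k = -1\<close>
    by (simp add: degree_rev_charpoly coeff_reflect_poly)
  have anti: "of_bool (n - i = gap c b) + of_bool (n - i = gap e a) - of_bool (n - i = gap c a)
      - of_bool (n - i = gap e b) = - (of_bool (i = gap c b) + of_bool (i = gap e a)
      - of_bool (i = gap c a) - of_bool (i = gap e b) :: complex)" if "0 < i" "i < n" for i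
  proof -
    have "coeff rev_charpoly k = of_bool (k = gap c b) + of_bool (k = gap e a) - of_bool (k = gap c a)
      - of_bool (k = gap e b)" if "0 < k" "k < n" for k
      using that by (simp add: coeff_rev_charpoly)
    from this[of i] this[of "n - i"] mirror[OF that(2)]
    show ?thesis using that by simp
  qed
  show ?thesis
    by (rule antisymmetric_exponents[OF gap_bounds(1,2,3,4,5,6,7,8) gap_neqs anti])
qed

text \<open>Both sums are congruent to c + e - a - b + 2.\<close>

lemma gap_sum_cong: "[gap c a + gap e b = gap c b + gap e a] (mod n)"
proof -
  have "[int (gap c a) + int (gap e b) = (c - a + 1) + (e - b + 1)] (mod int n)"
    by (intro cong_add gap_cong)
  also have "(c - a + 1) + (e - b + 1) = (c - b + 1) + (e - a + 1)" by simp
  also have "[(c - b + 1) + (e - a + 1) = int (gap c b) + int (gap e a)] (mod int n)"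
    by (intro cong_add cong_sym[OF gap_cong])
  finally show ?thesis by (simp flip: cong_int_iff)
qed

lemma finite_order_gaps:
  assumes "A ^\<^sub>m N = 1\<^sub>m n" "N > 0"
  obtains d j where "n = 2 * d" "1 \<le> j" "j < d" "two_part j \<noteq> two_part (d - j)"
    "gap c a = n - j" "gap e b = d + j"
    "gap c b = d - j \<and> gap e a = j \<or> gap c b = j \<and> gap e a = d - j"
proof -
  define \<sigma> where "\<sigma> = gap c a + gap e b"
  note sums = gap_sums[OF assms]
  have total: "\<sigma> + (gap c b + gap e a) = 2 * n" using sums unfolding \<sigma>_def by linarith
  have \<sigma>: "2 \<le> \<sigma>" "\<sigma> + 2 \<le> 2 * n" "\<sigma> \<noteq> n"
    using gap_bounds gap_neqs sums unfolding \<sigma>_def by linarith+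
  \<comment> \<open>The exponents of either sign have congruent sums, and these add up to 2 n, so 2
    \<sigma> is a multiple of \<open>n\<close>. The bounds and \<sigma> \<noteq> n leave only the
    quotients 1 and 3.\<close>
  have "[\<sigma> + \<sigma> = 2 * n] (mod n)"
    using cong_add[OF cong_refl[of \<sigma> n] gap_sum_cong] total by (simp add: \<sigma>_def)
  then have "n dvd 2 * \<sigma>" by (simp add: cong_def dvd_eq_mod_eq_0 flip: mult_2)
  then obtain t where t: "2 * \<sigma> = n * t" by (elim dvdE)
  have "t < 4"
  proof (rule ccontr)
    assume "\<not> t < 4"
    then have "n * 4 \<le> n * t" by (intro mult_le_mono2) simp
    then show False using t \<sigma> by linarith
  qed
  moreover have "t \<noteq> 0" by (rule notI) (use t \<sigma> in simp)
  moreover have "t \<noteq> 2" by (rule notI) (use t \<sigma> in simp)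
  ultimately consider "t = 1" | "t = 3" by linarith
  then show thesis
  proof cases
    case 1
    then have n: "n = 2 * \<sigma>" using t by simp
    define j where "j = gap c a"
    define l where "l = gap e b"
    have jl: "n = 2 * (j + l)" "0 < j" "0 < l"
      using gap_bounds n unfolding j_def l_def \<sigma>_def by auto
    \<comment> \<open>All three factors vanish at 1, against the bound of two on
      multiplicities.\<close>
    have "rev_charpoly = (1 - monom 1 j) * (1 - monom 1 l) * (1 - monom 1 (j + l))"
    proof -
      have q: "gap c a = j" "gap e b = l" by (simp_all add: j_def l_def)
      from sums have "gap c b = n - j \<and> gap e a = n - l \<or> gap e a = n - j \<and> gap c b = n - l"
        by (auto simp: j_def l_def)
      moreover have "n - j = j + 2 * l" "n - l = 2 * j + l" "monom (1 :: complex) n = monom 1 (2 * (j + l))"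
        using jl by auto
      ultimately show ?thesis
        using monom_cyclotomic_product[of "-1 :: complex" j l] q
        by (auto simp: rev_charpoly_gap minus_monom[symmetric])
    qed
    then have "[:-1, 1:] ^ 3 dvd rev_charpoly" by (simp only:) (rule three_roots_dvd, simp_all add: poly_monom)
    then show thesis using no_triple_root[OF rev_charpoly_dvd[OF assms(1)] n_pos assms(2)] by blast
  next
    case 2
    then have "2 * \<sigma> = 3 * n" using t by simp
    then have "even n" by presburger
    then obtain d where "n = 2 * d" by (elim evenE)
    with \<open>2 * \<sigma> = 3 * n\<close> have n: "n = 2 * d" "\<sigma> = 3 * d" by auto
    \<comment> \<open>Measuring the exponent from \<open>n\<close> produces the factorization with
      plus signs.\<close>
    define j where "j = n - gap c a"
    define l where "l = d - j"
    have jl: "d = j + l" "0 < j" "0 < l" "gap c a = n - j" "gap e b = d + j"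
      using gap_bounds n unfolding j_def l_def \<sigma>_def by auto
    have two: "gap c b = l \<and> gap e a = j \<or> gap c b = j \<and> gap e a = l"
      using sums jl n by auto
    have cp: "rev_charpoly = (1 + monom 1 j) * (1 + monom 1 l) * (1 - monom 1 (j + l))"
    proof -
      have "gap c a = j + 2 * l" "gap e b = 2 * j + l" "monom (1 :: complex) n = monom 1 (2 * (j + l))"
        using jl n by auto
      then show ?thesis
        using two monom_cyclotomic_product[of "1 :: complex" j l] by (auto simp: rev_charpoly_gap)
    qed
    have "two_part j \<noteq> two_part l"
    proof
      assume "two_part j = two_part l"
      then obtain \<zeta> :: complex where \<zeta>: "\<zeta> ^ j = -1" "\<zeta> ^ l = -1"
        using common_root_minus_1_exists jl by metis
      \<comment> \<open>Since \<zeta>^(j + l) is the product of -1 with itself, the third factor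
        vanishes at \<zeta> as well.\<close>
      have "[:-\<zeta>, 1:] ^ 3 dvd rev_charpoly"
        unfolding cp by (rule three_roots_dvd) (simp_all add: poly_monom \<zeta> power_add)
      then show False using no_triple_root[OF rev_charpoly_dvd[OF assms(1)] n_pos assms(2)] by blast
    qed
    moreover have "d - j = l" "1 \<le> j" "j < d" using jl by simp_all
    ultimately show thesis using that[of d j] n(1) jl(4,5) two by metis
  qed
qed

end

section \<open>The order\<close>

lemma one_plus_monom_dvd: "1 + monom 1 j dvd (1 - monom 1 (2 * j) :: 'a :: comm_ring_1 poly)"
proof -
  have "1 - monom 1 (2 * j) = (1 + monom 1 j) * (1 - monom 1 j :: 'a poly)"
    unfolding mult_2 by (simp add: ring_distribs mult_monom)
  then show ?thesis by simp
qed

text \<open>If one of the two powers is -1, then \<zeta>^(j + l) = 1 would make the other one -1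
  too, which different 2-parts exclude.\<close>

lemma factor_roots_distinct:
  fixes \<zeta> :: complex
  assumes "two_part j \<noteq> two_part l" "0 < j" "0 < l"
  shows "\<zeta> ^ j = -1 \<Longrightarrow> \<zeta> ^ l \<noteq> -1" "\<zeta> ^ j = -1 \<Longrightarrow> \<zeta> ^ (j + l) \<noteq> 1" "\<zeta> ^ l = -1 \<Longrightarrow> \<zeta> ^ (j + l) \<noteq> 1"
proof -
  have not_both: "\<not> (\<zeta> ^ j = -1 \<and> \<zeta> ^ l = -1)" using common_root_minus_1 assms by blast
  then show "\<zeta> ^ l \<noteq> -1" if "\<zeta> ^ j = -1" using that by blast
  have neg: "x * y \<noteq> 1" if "x = -1" "y \<noteq> -1" for x y :: complex
    using that by (metis minus_minus mult_minus1)
  show "\<zeta> ^ (j + l) \<noteq> 1" if "\<zeta> ^ j = -1"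
    unfolding power_add using that not_both by (intro neg) blast+
  show "\<zeta> ^ (j + l) \<noteq> 1" if "\<zeta> ^ l = -1"
    unfolding power_add using that not_both by (subst mult.commute, intro neg) blast+
qed

text \<open>Each factor divides 1 - z^L separately, as 1 + z^j divides 1 - z^(2 j); coprimality then
  passes this on to the product.\<close>

lemma cyclotomic_product_dvd:
  assumes "two_part j \<noteq> two_part l" "0 < j" "0 < l" "2 * j dvd L" "2 * l dvd L" "j + l dvd L"
  shows "(1 + monom 1 j) * (1 + monom 1 l) * (1 - monom 1 (j + l)) dvd (1 - monom 1 L :: complex poly)"
proof (rule divides_mult[OF divides_mult])
  show "1 + monom 1 j dvd (1 - monom 1 L :: complex poly)"
    using one_plus_monom_dvd one_minus_monom_dvd[OF assms(4)] by (rule dvd_trans)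
  show "1 + monom 1 l dvd (1 - monom 1 L :: complex poly)"
    using one_plus_monom_dvd one_minus_monom_dvd[OF assms(5)] by (rule dvd_trans)
  show "1 - monom 1 (j + l) dvd (1 - monom 1 L :: complex poly)"
    by (rule one_minus_monom_dvd[OF assms(6)])
  note roots = factor_roots_distinct[OF assms(1-3)]
  have nz: "1 + monom 1 m \<noteq> (0 :: complex poly)" if "m > 0" for m
    using that one_plus_monom_dvd[of m, where 'a = complex] one_minus_monom_neq_0[of "2 * m"] by auto
  have eq: "1 + x = 0 \<longleftrightarrow> x = -1" for x :: complex by (simp add: add_eq_0_iff)
  show "coprime (1 + monom 1 j) (1 + monom 1 l :: complex poly)"
    using roots(1) nz assms(2) by (intro coprime_complex_polyI) (auto simp: poly_monom eq)
  show "coprime ((1 + monom 1 j) * (1 + monom 1 l)) (1 - monom 1 (j + l) :: complex poly)"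
    using roots(2,3) nz assms(2,3) by (intro coprime_complex_polyI) (auto simp: poly_monom eq)
qed

context labelled_PT begin

context
  fixes d j :: nat
  assumes nd: "n = 2 * d" and j: "1 \<le> j" "j < d" and two_part_neq: "two_part j \<noteq> two_part (d - j)"
    and gaps: "gap c a = n - j" "gap e b = d + j" "gap c b = d - j" "gap e a = j"
begin

lemma rev_charpoly_factorization: "rev_charpoly = (1 + monom 1 j) * (1 + monom 1 (d - j)) * (1 - monom 1 d)"
proof -
  have e: "j + 2 * (d - j) = n - j" "2 * j + (d - j) = d + j" "j + (d - j) = d"
    using nd j by auto
  have m: "monom (1 :: complex) n = monom 1 (2 * d)" using nd by simp
  show ?thesis
    using monom_cyclotomic_product[of "1 :: complex" j "d - j"]
    unfolding e by (simp add: rev_charpoly_gap gaps m)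
qed

text \<open>The exponents make a - b congruent to d and c - e congruent to -2 j. Putting m = a and q
  = e in the root conditions turns one side into \<zeta>^0 = 1 and gives the two equations.\<close>

lemma non_fixed_root:
  assumes "A ^\<^sub>m k = 1\<^sub>m n" "poly rev_charpoly \<zeta> = 0" "\<zeta> ^ k \<noteq> 1"
  shows "\<zeta> ^ d = 1" "\<zeta> ^ (2 * j) = 1"
proof -
  have "[int (gap c b) - int (gap c a) = (c - b + 1) - (c - a + 1)] (mod int n)"
    by (intro cong_diff gap_cong)
  moreover have "int (gap c b) - int (gap c a) = - int d" unfolding gaps using j nd by linarith
  ultimately have "[a - b = - int d] (mod int n)" by (simp add: cong_sym_eq)
  also have "[- int d = int d] (mod int n)" by (simp add: cong_iff_dvd_diff nd)
  finally have "(a - b) mod int n = int d" using j nd by (simp add: cong_def)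
  then show *: "\<zeta> ^ d = 1" using rev_charpoly_root_left[OF assms, of a] by simp
  have "[int (gap c b) - int (gap e b) = (c - b + 1) - (e - b + 1)] (mod int n)"
    by (intro cong_diff gap_cong)
  moreover have "int (gap c b) - int (gap e b) = - 2 * int j" unfolding gaps using j nd by linarith
  ultimately have "[c - e = - 2 * int j] (mod int n)" by (simp add: cong_sym_eq)
  also have "[- 2 * int j = int (n - 2 * j)] (mod int n)"
    using j nd by (simp add: cong_iff_dvd_diff of_nat_diff)
  finally have "(c - e) mod int n = int (n - 2 * j) mod int n" unfolding cong_def .
  also have "\<dots> = int (n - 2 * j)" using j nd by (intro mod_pos_pos_trivial) auto
  finally have "(c - e) mod int n = int (n - 2 * j)" .
  then have "\<zeta> ^ (n - 2 * j) = 1" using rev_charpoly_root_right[OF assms, of e] by simp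
  moreover have "\<zeta> ^ n = \<zeta> ^ (n - 2 * j) * \<zeta> ^ (2 * j)" using j nd by (simp flip: power_add)
  moreover have "\<zeta> ^ n = 1" using * nd by (simp add: power_mult mult.commute)
  ultimately show "\<zeta> ^ (2 * j) = 1" by simp
qed

lemma power_eq_1_iff_dvd:
  assumes "k > 0"
  shows "A ^\<^sub>m k = 1\<^sub>m n \<longleftrightarrow> lcm (lcm (2 * j) (2 * d - 2 * j)) d dvd k"
proof
  assume dvd: "lcm (lcm (2 * j) (2 * d - 2 * j)) d dvd k"
  have e: "2 * d - 2 * j = 2 * (d - j)" "j + (d - j) = d" using j by auto
  have "rev_charpoly dvd 1 - monom 1 k"
    using cyclotomic_product_dvd[OF two_part_neq, of k] dvd j
    unfolding rev_charpoly_factorization e by simp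
  then show "A ^\<^sub>m k = 1\<^sub>m n" using degree_rev_charpoly assms by (rule power_eq_1)
next
  assume k: "A ^\<^sub>m k = 1\<^sub>m n"
  have d: "j + (d - j) = d" using j by simp
  note roots = factor_roots_distinct[OF two_part_neq, unfolded d]
  have "2 * j dvd k"
  proof -
    \<comment> \<open>This root of 1 + z^j is a root of F. If \<zeta>^k were not 1,
      \<open>non_fixed_root\<close> would give \<zeta>^d = 1, contrary to the separation of the
      factors.\<close>
    let ?\<zeta> = "cis (2 * pi / real (2 * j))"
    have m1: "?\<zeta> ^ j = -1" using j by (intro cis_half_power) simp
    then have "poly rev_charpoly ?\<zeta> = 0" by (simp add: rev_charpoly_factorization poly_monom)
    then have "?\<zeta> ^ k = 1" using non_fixed_root(1)[OF k] roots(2)[OF _ _ m1] j by auto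
    then show ?thesis using cis_root_power_eq_1_iff[of "2 * j" k] j by simp
  qed
  moreover have "2 * (d - j) dvd k"
  proof -
    let ?\<zeta> = "cis (2 * pi / real (2 * (d - j)))"
    have m1: "?\<zeta> ^ (d - j) = -1" using j by (intro cis_half_power) simp
    then have "poly rev_charpoly ?\<zeta> = 0" by (simp add: rev_charpoly_factorization poly_monom)
    then have "?\<zeta> ^ k = 1" using non_fixed_root(1)[OF k] roots(3)[OF _ _ m1] j by auto
    then show ?thesis using cis_root_power_eq_1_iff[of "2 * (d - j)" k] j by simp
  qed
  moreover have "d dvd k"
  proof (rule ccontr)
    \<comment> \<open>Now \<zeta>^d = 1 is no contradiction, so the second equation serves: d would
      divide 2 j < 2 d, hence d = 2 j, and j and d - j would have equal 2-parts.\<close>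
    let ?\<zeta> = "cis (2 * pi / real d)"
    assume "\<not> d dvd k"
    then have "?\<zeta> ^ k \<noteq> 1" using cis_root_power_eq_1_iff[of d k] j by simp
    moreover have "?\<zeta> ^ d = 1" using cis_root_power_eq_1_iff[of d d] j by simp
    then have "poly rev_charpoly ?\<zeta> = 0" by (simp add: rev_charpoly_factorization poly_monom)
    ultimately have "?\<zeta> ^ (2 * j) = 1" using non_fixed_root(2)[OF k] by blast
    then have "d dvd 2 * j" using cis_root_power_eq_1_iff[of d "2 * j"] j by simp
    then obtain t where t: "2 * j = d * t" by (elim dvdE)
    have "t < 2"
    proof (rule ccontr)
      assume "\<not> t < 2"
      then have "d * 2 \<le> d * t" by (intro mult_le_mono2) simp
      then show False using t j by linarith
    qed
    moreover have "t \<noteq> 0" by (rule notI) (use t j in simp)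
    ultimately have "t = 1" by simp
    then have "d - j = j" using t by simp
    then show False using two_part_neq by simp
  qed
  ultimately show "lcm (lcm (2 * j) (2 * d - 2 * j)) d dvd k"
    by (simp add: diff_mult_distrib2)
qed

lemma finite_order: "has_finite_order A"
  and order_formula: "mult_order A = lcm (lcm (2 * j) (2 * d - 2 * j)) d"
proof -
  let ?L = "lcm (lcm (2 * j) (2 * d - 2 * j)) d"
  have L: "?L > 0" using j by (intro lcm_pos_nat) auto
  have dim: "dim_row A = n" using carrier by simp
  have pow: "A ^\<^sub>m ?L = 1\<^sub>m n" using power_eq_1_iff_dvd[OF L] by (rule iffD2) simp
  show "has_finite_order A"
    unfolding has_finite_order_def dim by (intro exI[of _ ?L] conjI L pow)
  show "mult_order A = ?L"
    unfolding mult_order_def dim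
  proof (rule Least_equality)
    show "0 < ?L \<and> A ^\<^sub>m ?L = 1\<^sub>m n" using L pow by (rule conjI)
    show "?L \<le> k" if "0 < k \<and> A ^\<^sub>m k = 1\<^sub>m n" for k
      using that power_eq_1_iff_dvd[of k] by (meson dvd_imp_le)
  qed
qed

end
end

section \<open>Permutation similarity\<close>

lemma perm_mat_index:
  "i < n \<Longrightarrow> k < n \<Longrightarrow> perm_mat n \<sigma> $$ (i, k) = of_bool (Suc i = \<sigma> (Suc k))"
  by (simp add: perm_mat_def mat_of_entries_def)

lemma T_mat_index:
  assumes "i1 \<noteq> i2" "j1 \<noteq> j2" "i < n" "k < n"
  shows "T_mat n i1 j1 i2 j2 $$ (i, k) = (of_bool (Suc i = i1) - of_bool (Suc i = i2)) *
    (of_bool (Suc k = j1) - of_bool (Suc k = j2))"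
  using assms by (auto simp: T_mat_def mat_of_entries_def)

lemma C_mat_index:
  "i < n \<Longrightarrow> k < n \<Longrightarrow> C_mat n $$ (i, k) = of_bool (if Suc k < n then i = Suc k else i = 0)"
  by (auto simp: C_mat_def mat_of_entries_def)

lemma carrier_perm_mat: "perm_mat n \<sigma> \<in> carrier_mat n n"
  and carrier_C_mat: "C_mat n \<in> carrier_mat n n"
  and carrier_T_mat: "T_mat n i1 j1 i2 j2 \<in> carrier_mat n n"
  by (simp_all add: perm_mat_def C_mat_def T_mat_def mat_of_entries_def)

lemma mult_mat_index_sum:
  assumes "X \<in> carrier_mat n n" "Y \<in> carrier_mat n n" "i < n" "k < n"
  shows "(X * Y) $$ (i, k) = (\<Sum>q<n. X $$ (i, q) * Y $$ (q, k))"
  using assms by (simp add: scalar_prod_def lessThan_atLeast0)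

text \<open>The permutation acts on indices from 1 and the matrices are indexed from 0, whence
  \<open>Suc\<close> and the subtraction of 1.\<close>

lemma perm_mat_conj_index:
  assumes \<sigma>: "\<sigma> permutes {1..n}" and A: "A \<in> carrier_mat n n" and "i < n" "k < n"
  shows "(transpose_mat (perm_mat n \<sigma>) * A * perm_mat n \<sigma>) $$ (i, k) = A $$ (\<sigma> (Suc i) - 1, \<sigma> (Suc k) - 1)"
proof -
  let ?R = "perm_mat n \<sigma>"
  have \<sigma>_in: "\<sigma> (Suc x) \<in> {1..n}" if "x < n" for x
    using that permutes_in_image[OF \<sigma>, of "Suc x"] by auto
  have lt: "\<sigma> (Suc x) - 1 < n" if "x < n" for x using \<sigma>_in[OF that] by auto
  have R: "?R $$ (p, x) = of_bool (p = \<sigma> (Suc x) - 1)" if "p < n" "x < n" for p x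
    using that \<sigma>_in[of x] by (auto simp: perm_mat_index)
  have RA: "(transpose_mat ?R * A) $$ (i, q) = A $$ (\<sigma> (Suc i) - 1, q)" if "q < n" for q
  proof -
    have "(transpose_mat ?R * A) $$ (i, q) = (\<Sum>p<n. ?R $$ (p, i) * A $$ (p, q))"
      using that assms carrier_perm_mat[of n \<sigma>]
      by (subst mult_mat_index_sum[where n = n]) auto
    also have "\<dots> = (\<Sum>p<n. if p = \<sigma> (Suc i) - 1 then A $$ (p, q) else 0)"
      using R assms(3) by (intro sum.cong) auto
    finally show ?thesis using lt[OF assms(3)] by simp
  qed
  have "(transpose_mat ?R * A * ?R) $$ (i, k) = (\<Sum>q<n. (transpose_mat ?R * A) $$ (i, q) * ?R $$ (q, k))"
    using assms carrier_perm_mat[of n \<sigma>] by (intro mult_mat_index_sum) auto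
  also have "\<dots> = (\<Sum>q<n. if q = \<sigma> (Suc k) - 1 then A $$ (\<sigma> (Suc i) - 1, q) else 0)"
    using R RA assms(4) by (intro sum.cong) auto
  finally show ?thesis using lt[OF assms(4)] by simp
qed

lemma perm_similar_iff:
  assumes A: "A \<in> carrier_mat n n" and B: "B \<in> carrier_mat n n"
  shows "perm_similar n A B \<longleftrightarrow>
    (\<exists>f. bij_betw f {..<n} {..<n} \<and> (\<forall>i<n. \<forall>k<n. B $$ (i, k) = A $$ (f i, f k)))"
proof
  assume "perm_similar n A B"
  then obtain \<sigma> where \<sigma>: "\<sigma> permutes {1..n}" and eq: "B = transpose_mat (perm_mat n \<sigma>) * A * perm_mat n \<sigma>"
    by (auto simp: perm_similar_def is_perm_mat_def)
  have "bij_betw Suc {..<n} {1..n}"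
    by (rule bij_betw_byWitness[of _ "\<lambda>x. x - 1"]) auto
  moreover have "bij_betw \<sigma> {1..n} {1..n}" by (rule permutes_imp_bij[OF \<sigma>])
  moreover have "bij_betw (\<lambda>x. x - 1) {1..n} {..<n}"
    by (rule bij_betw_byWitness[of _ Suc]) auto
  ultimately have "bij_betw ((\<lambda>x. x - 1) \<circ> (\<sigma> \<circ> Suc)) {..<n} {..<n}"
    by (meson bij_betw_trans)
  then show "\<exists>f. bij_betw f {..<n} {..<n} \<and> (\<forall>i<n. \<forall>k<n. B $$ (i, k) = A $$ (f i, f k))"
    using perm_mat_conj_index[OF \<sigma> A]
    by (intro exI[of _ "(\<lambda>x. x - 1) \<circ> (\<sigma> \<circ> Suc)"]) (simp add: eq)
next
  assume "\<exists>f. bij_betw f {..<n} {..<n} \<and> (\<forall>i<n. \<forall>k<n. B $$ (i, k) = A $$ (f i, f k))"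
  then obtain f where f: "bij_betw f {..<n} {..<n}" "\<And>i k. i < n \<Longrightarrow> k < n \<Longrightarrow> B $$ (i, k) = A $$ (f i, f k)"
    by blast
  define \<sigma> where "\<sigma> x = (if x \<in> {1..n} then Suc (f (x - 1)) else x)" for x
  have "bij_betw (\<lambda>x. x - 1) {1..n} {..<n}"
    by (rule bij_betw_byWitness[of _ Suc]) auto
  moreover have "bij_betw Suc {..<n} {1..n}"
    by (rule bij_betw_byWitness[of _ "\<lambda>x. x - 1"]) auto
  ultimately have "bij_betw (Suc \<circ> (f \<circ> (\<lambda>x. x - 1))) {1..n} {1..n}"
    using f(1) by (meson bij_betw_trans)
  then have "bij_betw \<sigma> {1..n} {1..n}"
    by (subst bij_betw_cong[of _ _ "Suc \<circ> (f \<circ> (\<lambda>x. x - 1))"]) (auto simp: \<sigma>_def)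
  then have \<sigma>: "\<sigma> permutes {1..n}" by (rule bij_imp_permutes) (auto simp: \<sigma>_def)
  have "B = transpose_mat (perm_mat n \<sigma>) * A * perm_mat n \<sigma>"
  proof (rule eq_matI)
    fix i k assume "i < dim_row (transpose_mat (perm_mat n \<sigma>) * A * perm_mat n \<sigma>)"
      "k < dim_col (transpose_mat (perm_mat n \<sigma>) * A * perm_mat n \<sigma>)"
    then have ik: "i < n" "k < n" using carrier_perm_mat[of n \<sigma>] by auto
    then show "B $$ (i, k) = (transpose_mat (perm_mat n \<sigma>) * A * perm_mat n \<sigma>) $$ (i, k)"
      unfolding perm_mat_conj_index[OF \<sigma> A ik] f(2)[OF ik] by (simp add: \<sigma>_def)
  qed (use A B carrier_perm_mat[of n \<sigma>] in auto)
  with \<sigma> show "perm_similar n A B" unfolding perm_similar_def is_perm_mat_def by blast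
qed

section \<open>Transformations of labellings\<close>

context labelled_PT begin

lemma entry_cong:
  "A $$ (\<phi> x, \<phi> q) = of_bool ([x = q + 1] (mod int n)) +
     (of_bool ([x = a] (mod int n)) - of_bool ([x = b] (mod int n))) *
     (of_bool ([q = c] (mod int n)) - of_bool ([q = e] (mod int n)))"
  using entry[of "\<phi> x" q] by (simp add: label_eq)

text \<open>Transposition reverses the cycle, which negating the labels undoes, and exchanges the
  roles of u and v.\<close>

lemma labelled_transpose:
  "labelled_PT n (transpose_mat A) (\<lambda>x. \<phi> (- x)) (- c) (- e) (- a) (- b)"
proof
  have neg: "[- x = - y] (mod int n) \<longleftrightarrow> [x = y] (mod int n)" for x y
    by (simp add: cong_minus_minus_iff)
  have eq_minus: "\<phi> (- x) = \<phi> y \<longleftrightarrow> \<phi> x = \<phi> (- y)" for x y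
    unfolding label_eq by (metis neg minus_minus)
  show "0 < n" by (rule n_pos)
  show "transpose_mat A \<in> carrier_mat n n" using carrier by simp
  show "range (\<lambda>x. \<phi> (- x)) = {..<n}"
  proof -
    have "\<phi> y \<in> range (\<lambda>x. \<phi> (- x))" for y by (rule range_eqI[of _ _ "- y"]) simp
    then have "{..<n} \<subseteq> range (\<lambda>x. \<phi> (- x))" unfolding range[symmetric] by (intro image_subsetI)
    then show ?thesis by (intro equalityI) auto
  qed
  show "\<phi> (- x) = \<phi> (- y) \<longleftrightarrow> [x = y] (mod int n)" for x y by (simp add: label_eq neg)
  show "\<phi> (- (- c)) \<noteq> \<phi> (- (- e))" "\<phi> (- (- a)) \<noteq> \<phi> (- (- b))" using rows cols by simp_all
  have dis: "\<phi> (- (- x + 1)) \<noteq> \<phi> (- (- y))" if "\<phi> (y + 1) \<noteq> \<phi> x" for x y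
  proof
    assume "\<phi> (- (- x + 1)) = \<phi> (- (- y))"
    then have "[x - 1 = y] (mod int n)" by (simp add: label_eq)
    then have "[x - 1 + 1 = y + 1] (mod int n)" by (intro cong_add cong_refl)
    then show False using that by (simp add: label_eq cong_sym_eq)
  qed
  show "\<phi> (- (- a + 1)) \<noteq> \<phi> (- (- c))" "\<phi> (- (- a + 1)) \<noteq> \<phi> (- (- e))"
    "\<phi> (- (- b + 1)) \<noteq> \<phi> (- (- c))" "\<phi> (- (- b + 1)) \<noteq> \<phi> (- (- e))"
    by (rule dis, rule disjoint)+
  fix i q assume i: "i < n"
  then obtain x where x: "i = \<phi> x" using range by auto
  have "[- q = x + 1] (mod int n) \<longleftrightarrow> [x = - (q + 1)] (mod int n)"
    by (simp add: cong_iff_dvd_diff) (metis dvd_minus_iff minus_diff_eq diff_minus_eq_add add.commute add.left_commute minus_add_distrib uminus_add_conv_diff)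
  then show "transpose_mat A $$ (i, \<phi> (- q)) = of_bool (i = \<phi> (- (q + 1))) +
      (of_bool (i = \<phi> (- (- c))) - of_bool (i = \<phi> (- (- e)))) *
      (of_bool (\<phi> (- q) = \<phi> (- (- a))) - of_bool (\<phi> (- q) = \<phi> (- (- b))))"
    using carrier by (simp add: x entry_cong label_eq mult.commute)
qed

lemma labelled_shift:
  "labelled_PT n A (\<lambda>x. \<phi> (x + t)) (a - t) (b - t) (c - t) (e - t)"
proof
  show "range (\<lambda>x. \<phi> (x + t)) = {..<n}"
  proof -
    have "\<phi> y \<in> range (\<lambda>x. \<phi> (x + t))" for y by (rule range_eqI[of _ _ "y - t"]) simp
    then have "{..<n} \<subseteq> range (\<lambda>x. \<phi> (x + t))" unfolding range[symmetric] by (intro image_subsetI)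
    then show ?thesis by (intro equalityI) auto
  qed
  show "\<phi> (x + t) = \<phi> (y + t) \<longleftrightarrow> [x = y] (mod int n)" for x y
    by (simp add: label_eq cong_add_rcancel)
  fix i q assume "i < n"
  then show "A $$ (i, \<phi> (q + t)) = of_bool (i = \<phi> (q + 1 + t)) +
      (of_bool (i = \<phi> (a - t + t)) - of_bool (i = \<phi> (b - t + t))) *
      (of_bool (\<phi> (q + t) = \<phi> (c - t + t)) - of_bool (\<phi> (q + t) = \<phi> (e - t + t)))"
    by (simp add: entry add.commute add.left_commute)
qed (use n_pos carrier rows cols disjoint in \<open>simp_all add: algebra_simps\<close>)

lemma labelled_cong:
  assumes "\<phi> a' = \<phi> a" "\<phi> b' = \<phi> b" "\<phi> c' = \<phi> c" "\<phi> e' = \<phi> e"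
  shows "labelled_PT n A \<phi> a' b' c' e'"
proof
  have plus: "\<phi> (x + 1) = \<phi> (y + 1)" if "\<phi> x = \<phi> y" for x y
    using that unfolding label_eq by (intro cong_add cong_refl)
  show "\<phi> (c' + 1) \<noteq> \<phi> a'" "\<phi> (c' + 1) \<noteq> \<phi> b'" "\<phi> (e' + 1) \<noteq> \<phi> a'" "\<phi> (e' + 1) \<noteq> \<phi> b'"
    using disjoint unfolding plus[OF assms(3)] plus[OF assms(4)] assms(1,2) .
  show "\<phi> a' \<noteq> \<phi> b'" "\<phi> c' \<noteq> \<phi> e'" unfolding assms by (rule rows cols)+
  show "A $$ (i, \<phi> q) = of_bool (i = \<phi> (q + 1)) + (of_bool (i = \<phi> a') - of_bool (i = \<phi> b')) *
      (of_bool (\<phi> q = \<phi> c') - of_bool (\<phi> q = \<phi> e'))" if "i < n" for i q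
    unfolding assms by (rule entry[OF that])
qed (rule n_pos carrier range label_eq)+

end

text \<open>The parameters and congruence modulo \<open>n\<close> determine every entry, so matching
  equal labels carries one matrix to the other.\<close>

lemma labelled_perm_similar:
  assumes "labelled_PT n A \<phi> a b c e" "labelled_PT n B \<psi> a b c e"
  shows "perm_similar n A B"
proof -
  interpret A: labelled_PT n A \<phi> a b c e by fact
  interpret B: labelled_PT n B \<psi> a b c e by fact
  define g where "g = inv_into UNIV \<psi>"
  have g: "\<psi> (g i) = i" if "i < n" for i
    unfolding g_def by (rule f_inv_into_f) (use that B.range in blast)
  have "inj_on (\<phi> \<circ> g) {..<n}"
    by (rule inj_onI) (metis A.label_eq B.label_eq comp_apply g lessThan_iff)
  moreover have "(\<phi> \<circ> g) ` {..<n} \<subseteq> {..<n}" by auto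
  ultimately have "bij_betw (\<phi> \<circ> g) {..<n} {..<n}"
    unfolding bij_betw_def by (intro conjI endo_inj_surj) auto
  moreover have "B $$ (i, k) = A $$ ((\<phi> \<circ> g) i, (\<phi> \<circ> g) k)" if "i < n" "k < n" for i k
    using A.entry_cong[of "g i" "g k"] B.entry_cong[of "g i" "g k"] g that by simp
  ultimately show ?thesis unfolding perm_similar_iff[OF A.carrier B.carrier] by blast
qed

lemma perm_similar_labelled:
  assumes B: "labelled_PT n B \<psi> a b c e" and A: "A \<in> carrier_mat n n" and sim: "perm_similar n A B"
  shows "\<exists>\<phi>. labelled_PT n A \<phi> a b c e"
proof -
  interpret B: labelled_PT n B \<psi> a b c e by fact
  obtain f where f: "bij_betw f {..<n} {..<n}" "\<And>i k. i < n \<Longrightarrow> k < n \<Longrightarrow> B $$ (i, k) = A $$ (f i, f k)"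
    using sim unfolding perm_similar_iff[OF A B.carrier] by blast
  have inj: "f i = f k \<longleftrightarrow> i = k" if "i < n" "k < n" for i k
    using f(1) that by (metis bij_betw_imp_inj_on inj_onD lessThan_iff)
  have "labelled_PT n A (f \<circ> \<psi>) a b c e"
  proof
    show "range (f \<circ> \<psi>) = {..<n}"
      using B.range f(1) by (metis bij_betw_imp_surj_on image_comp)
    show "(f \<circ> \<psi>) x = (f \<circ> \<psi>) y \<longleftrightarrow> [x = y] (mod int n)" for x y
      by (simp add: inj B.label_eq)
    fix i q assume "i < n"
    then obtain k where k: "k < n" "i = f k"
      using f(1) by (metis bij_betw_imp_surj_on imageE lessThan_iff)
    then show "A $$ (i, (f \<circ> \<psi>) q) = of_bool (i = (f \<circ> \<psi>) (q + 1)) +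
      (of_bool (i = (f \<circ> \<psi>) a) - of_bool (i = (f \<circ> \<psi>) b)) *
      (of_bool ((f \<circ> \<psi>) q = (f \<circ> \<psi>) c) - of_bool ((f \<circ> \<psi>) q = (f \<circ> \<psi>) e))"
      using B.entry[OF k(1), of q] f(2)[OF k(1), of "\<psi> q"] by (simp add: inj)
  qed (use B.n_pos A B.rows B.cols B.disjoint in \<open>simp_all add: inj\<close>)
  then show ?thesis by blast
qed

section \<open>Labellings of the standard form and of type 1 matrices\<close>

lemma labelled_standard_form:
  assumes n: "n = 2 * d" and j: "1 \<le> j" "j < d"
  shows "labelled_PT n (C_mat n + T_mat n 1 (n - j) (d + 1) j) (\<lambda>x. nat ((x - 1) mod int n))
    1 (int d + 1) (int n - int j) (int j)"
proof -
  \<comment> \<open>Label x denotes row x counted from 1, modulo \<open>n\<close>; subtracting 1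
    passes to indices from 0.\<close>
  let ?\<phi> = "\<lambda>x. nat ((x - 1) mod int n)"
  have n_pos: "n > 0" using n j by simp
  have less: "?\<phi> x < n" for x using n_pos by (simp add: nat_less_iff)
  have label: "?\<phi> x = ?\<phi> y \<longleftrightarrow> [x = y] (mod int n)" for x y
  proof -
    have "?\<phi> x = ?\<phi> y \<longleftrightarrow> [x - 1 = y - 1] (mod int n)"
      using n_pos by (simp add: cong_def eq_nat_nat_iff)
    also have "\<dots> \<longleftrightarrow> [x = y] (mod int n)" by (simp add: cong_iff_dvd_diff)
    finally show ?thesis .
  qed
  have val: "?\<phi> (int k + 1) = k" if "k < n" for k using that by simp
  have val1: "?\<phi> 1 = 0" "?\<phi> (int d + 1) = d" "?\<phi> (int n - int j) = n - j - 1" "?\<phi> (int j) = j - 1"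
    "?\<phi> (int n - int j + 1) = n - j" "?\<phi> (int j + 1) = j"
    using n j val[of 0] val[of d] val[of "n - j - 1"] val[of "j - 1"] val[of "n - j"] val[of j] by (simp_all add: of_nat_diff)
  show ?thesis
  proof
    show "range ?\<phi> = {..<n}"
    proof
      show "{..<n} \<subseteq> range ?\<phi>"
      proof
        fix k assume "k \<in> {..<n}"
        then show "k \<in> range ?\<phi>" by (intro range_eqI[of _ _ "int k + 1"]) (simp add: val)
      qed
    qed (use less in auto)
    show "C_mat n + T_mat n 1 (n - j) (d + 1) j \<in> carrier_mat n n"
      using carrier_C_mat carrier_T_mat by simp
    fix i q assume i: "i < n"
    have succ: "?\<phi> (q + 1) = (if Suc (?\<phi> q) < n then Suc (?\<phi> q) else 0)"
    proof -
      have "[q + 1 = int (?\<phi> q) + 2] (mod int n)"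
        using n_pos by (simp add: cong_def mod_simps) (simp add: algebra_simps mod_simps)
      then have eq: "?\<phi> (q + 1) = ?\<phi> (int (?\<phi> q) + 2)" by (simp only: label)
      show ?thesis
      proof (cases "Suc (?\<phi> q) < n")
        case True
        then show ?thesis unfolding eq using val[of "Suc (?\<phi> q)"] by simp
      next
        case False
        then have "int (?\<phi> q) + 2 = int n + 1" using less[of q] by linarith
        then show ?thesis unfolding eq using False by simp
      qed
    qed
    have "(C_mat n + T_mat n 1 (n - j) (d + 1) j) $$ (i, ?\<phi> q) =
      C_mat n $$ (i, ?\<phi> q) + T_mat n 1 (n - j) (d + 1) j $$ (i, ?\<phi> q)"
      using i less carrier_C_mat[of n] carrier_T_mat[of n 1 "n - j" "d + 1" j] by (intro index_add_mat) auto
    also have "C_mat n $$ (i, ?\<phi> q) = of_bool (i = ?\<phi> (q + 1))"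
      unfolding C_mat_index[OF i less] succ by simp
    also have "T_mat n 1 (n - j) (d + 1) j $$ (i, ?\<phi> q) =
      (of_bool (i = 0) - of_bool (i = d)) * (of_bool (?\<phi> q = n - j - 1) - of_bool (?\<phi> q = j - 1))"
    proof -
      have "Suc (?\<phi> q) = n - j \<longleftrightarrow> ?\<phi> q = n - j - 1" "Suc (?\<phi> q) = j \<longleftrightarrow> ?\<phi> q = j - 1"
        using n j by auto
      moreover have "n - j \<noteq> j" "(1::nat) \<noteq> d + 1" using n j by auto
      ultimately show ?thesis using T_mat_index[OF _ _ i less] by simp
    qed
    finally show "(C_mat n + T_mat n 1 (n - j) (d + 1) j) $$ (i, ?\<phi> q) = of_bool (i = ?\<phi> (q + 1)) +
      (of_bool (i = ?\<phi> 1) - of_bool (i = ?\<phi> (int d + 1))) *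
      (of_bool (?\<phi> q = ?\<phi> (int n - int j)) - of_bool (?\<phi> q = ?\<phi> (int j)))"
      unfolding val1 .
  next
    show "?\<phi> 1 \<noteq> ?\<phi> (int d + 1)" "?\<phi> (int n - int j) \<noteq> ?\<phi> (int j)"
      "?\<phi> (int n - int j + 1) \<noteq> ?\<phi> 1" "?\<phi> (int n - int j + 1) \<noteq> ?\<phi> (int d + 1)"
      "?\<phi> (int j + 1) \<noteq> ?\<phi> 1" "?\<phi> (int j + 1) \<noteq> ?\<phi> (int d + 1)"
      unfolding val1 using n j by auto
  qed (rule n_pos label)+
qed

text \<open>Label x goes to the iterate of 1 under the cycle with exponent x mod n. The orbit of 1
  is all of {1..n}, so its length is \<open>n\<close>.\<close>

lemma labelled_of_PT_type1:
  assumes "is_PT_type1 n A"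
  shows "\<exists>\<phi> a b c e. labelled_PT n A \<phi> a b c e"
proof -
  obtain P T where P: "is_n_cycle_mat n P" and T: "is_T_block n T" and A: "A = P + T"
    and disj: "{(r, c). r < n \<and> c < n \<and> T $$ (r, c) \<noteq> 0} \<inter> {(r, c). r < n \<and> c < n \<and> P $$ (r, c) = 1} = {}"
    using assms unfolding is_PT_type1_def by blast
  obtain \<sigma> where \<sigma>: "\<sigma> permutes {1..n}" "cyclic_on \<sigma> {1..n}" "P = perm_mat n \<sigma>"
    using P unfolding is_n_cycle_mat_def by blast
  obtain i1 j1 i2 j2 where ij: "i1 \<in> {1..n}" "j1 \<in> {1..n}" "i2 \<in> {1..n}" "j2 \<in> {1..n}"
    "i1 \<noteq> i2" "j1 \<noteq> j2" and T: "T = T_mat n i1 j1 i2 j2"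
    using T unfolding is_T_block_def by blast
  have n_pos: "n > 0" using ij(1) by auto
  have orbit: "orbit \<sigma> 1 = {1..n}" using \<sigma>(2) n_pos by (intro orbit_cyclic_eq3) auto
  then have self: "1 \<in> orbit \<sigma> 1" using n_pos by simp
  let ?p = "funpow_dist1 \<sigma> 1 1"
  have image: "{1..n} = (\<lambda>k. (\<sigma> ^^ k) 1) ` {0..<?p}"
    using orbit_conv_funpow_dist1[OF self] orbit by simp
  have inj: "inj_on (\<lambda>k. (\<sigma> ^^ k) 1) {0..<?p}" by (rule inj_on_funpow_dist1[OF self])
  have "card {1..n} = card {0..<?p}" unfolding image by (rule card_image[OF inj])
  then have p: "?p = n" by simp
  have period: "(\<sigma> ^^ n) 1 = 1" using funpow_dist1_prop[OF self] unfolding p .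
  define \<phi> where "\<phi> x = (\<sigma> ^^ nat (x mod int n)) 1 - 1" for x
  have nat_mod: "nat (x mod int n) < n" for x using n_pos by (simp add: nat_less_iff)
  have Suc_\<phi>: "Suc (\<phi> x) = (\<sigma> ^^ nat (x mod int n)) 1" for x
  proof -
    have "(\<sigma> ^^ nat (x mod int n)) 1 \<in> {1..n}" unfolding image p using nat_mod[of x] by auto
    then show ?thesis by (auto simp: \<phi>_def)
  qed
  have \<phi>_succ: "\<sigma> (Suc (\<phi> q)) = Suc (\<phi> (q + 1))" for q
  proof -
    have "int (Suc (nat (q mod int n)) mod n) = (q + 1) mod int n"
      using n_pos by (simp add: zmod_int mod_simps add.commute)
    then have "nat ((q + 1) mod int n) = Suc (nat (q mod int n)) mod n" by linarith
    then show ?thesis unfolding Suc_\<phi> using funpow_mod_eq[OF period, of "Suc (nat (q mod int n))"] by simp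
  qed
  have range: "\<exists>x. Suc (\<phi> x) = y" if "y \<in> {1..n}" for y
  proof -
    have "y \<in> (\<lambda>k. (\<sigma> ^^ k) 1) ` {0..<n}" using that image unfolding p by blast
    then obtain k where "k < n" "y = (\<sigma> ^^ k) 1" by auto
    then show ?thesis by (intro exI[of _ "int k"]) (simp add: Suc_\<phi>)
  qed
  obtain a b c e where abce: "Suc (\<phi> a) = i1" "Suc (\<phi> b) = i2" "Suc (\<phi> c) = j1" "Suc (\<phi> e) = j2"
    using range ij(1-4) by metis
  have \<phi>_less: "\<phi> x < n" for x
  proof -
    have "Suc (\<phi> x) \<in> {1..n}" unfolding Suc_\<phi> image p using nat_mod[of x] by auto
    then show ?thesis by simp
  qed
  have P_index: "P $$ (i, \<phi> q) = of_bool (i = \<phi> (q + 1))" if "i < n" for i q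
    using that \<phi>_less by (simp add: \<sigma>(3) perm_mat_index \<phi>_succ)
  have T_index: "T $$ (i, \<phi> q) = (of_bool (i = \<phi> a) - of_bool (i = \<phi> b)) *
      (of_bool (\<phi> q = \<phi> c) - of_bool (\<phi> q = \<phi> e))" if "i < n" for i q
    using T_mat_index[OF ij(5,6) that \<phi>_less, of q] unfolding T by (simp flip: abce)
  have ne: "\<phi> a \<noteq> \<phi> b" "\<phi> c \<noteq> \<phi> e" using ij(5,6) abce by auto
  have dis: "\<phi> (q + 1) \<noteq> \<phi> x" if "T $$ (\<phi> x, \<phi> q) \<noteq> 0" for x q
  proof
    assume "\<phi> (q + 1) = \<phi> x"
    then have "P $$ (\<phi> x, \<phi> q) = 1" using P_index[OF \<phi>_less] by simp
    then show False using disj that \<phi>_less by blast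
  qed
  have "labelled_PT n A \<phi> a b c e"
  proof
    show "A \<in> carrier_mat n n" unfolding A T \<sigma>(3) using carrier_perm_mat carrier_T_mat by simp
    show "range \<phi> = {..<n}"
    proof
      show "{..<n} \<subseteq> range \<phi>"
      proof
        fix y assume "y \<in> {..<n}"
        then obtain x where "Suc (\<phi> x) = Suc y" using range[of "Suc y"] by auto
        then show "y \<in> range \<phi>" by auto
      qed
    qed (use \<phi>_less in auto)
    show "\<phi> x = \<phi> y \<longleftrightarrow> [x = y] (mod int n)" for x y
    proof -
      have "\<phi> x = \<phi> y \<longleftrightarrow> Suc (\<phi> x) = Suc (\<phi> y)" by simp
      also have "\<dots> \<longleftrightarrow> nat (x mod int n) = nat (y mod int n)"
        unfolding Suc_\<phi> using inj[unfolded p] nat_mod by (intro inj_on_eq_iff) auto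
      also have "\<dots> \<longleftrightarrow> [x = y] (mod int n)" using n_pos by (simp add: cong_def eq_nat_nat_iff)
      finally show ?thesis .
    qed
    fix i q assume i: "i < n"
    have "A $$ (i, \<phi> q) = P $$ (i, \<phi> q) + T $$ (i, \<phi> q)"
      unfolding A using i \<phi>_less carrier_T_mat[of n i1 j1 i2 j2] by (intro index_add_mat) (auto simp: T)
    then show "A $$ (i, \<phi> q) = of_bool (i = \<phi> (q + 1)) + (of_bool (i = \<phi> a) - of_bool (i = \<phi> b)) *
      (of_bool (\<phi> q = \<phi> c) - of_bool (\<phi> q = \<phi> e))"
      by (simp only: P_index[OF i] T_index[OF i])
  next
    show "\<phi> (c + 1) \<noteq> \<phi> a" "\<phi> (c + 1) \<noteq> \<phi> b" "\<phi> (e + 1) \<noteq> \<phi> a" "\<phi> (e + 1) \<noteq> \<phi> b"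
      by (rule dis; use ne ne[symmetric] in \<open>simp add: T_index[OF \<phi>_less]\<close>)+
  qed (rule n_pos ne)+
  then show ?thesis by blast
qed

section \<open>Powers and orders of transposes\<close>

lemma pow_transpose_mat:
  assumes "A \<in> carrier_mat n n"
  shows "transpose_mat A ^\<^sub>m k = transpose_mat (A ^\<^sub>m k :: 'a :: comm_semiring_1 mat)"
proof (induction k)
  case (Suc k)
  have "A ^\<^sub>m Suc k = A * A ^\<^sub>m k"
    using pow_mat_add_exponent[OF assms, of 1 k] assms by simp
  then show ?case using Suc transpose_mult[of A n n "A ^\<^sub>m k" n] assms by simp
qed (use assms in simp)

lemma pow_transpose_eq_1_iff:
  fixes A :: "int mat"
  assumes "A \<in> carrier_mat n n"
  shows "transpose_mat A ^\<^sub>m k = 1\<^sub>m (dim_row (transpose_mat A)) \<longleftrightarrow> A ^\<^sub>m k = 1\<^sub>m (dim_row A)"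
proof -
  have "transpose_mat (A ^\<^sub>m k) = 1\<^sub>m n \<longleftrightarrow> A ^\<^sub>m k = 1\<^sub>m n"
    by (metis transpose_transpose transpose_one)
  then show ?thesis using assms by (simp add: pow_transpose_mat[OF assms])
qed

lemma order_transpose:
  fixes A :: "int mat"
  assumes "A \<in> carrier_mat n n"
  shows "has_finite_order (transpose_mat A) \<longleftrightarrow> has_finite_order A"
    and "mult_order (transpose_mat A) = mult_order A"
  unfolding has_finite_order_def mult_order_def pow_transpose_eq_1_iff[OF assms] by simp_all

text \<open>Labels are free up to translation. Once a is moved to 1, the three exponents fix b, c
  and e modulo \<open>n\<close> to the values of the standard form.\<close>

lemma (in labelled_PT) perm_similar_standard_form:
  assumes n: "n = 2 * d" and j: "1 \<le> j" "j < d"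
    and gaps: "gap c a = n - j" "gap c b = d - j" "gap e a = j"
  shows "perm_similar n A (C_mat n + T_mat n 1 (n - j) (d + 1) j)"
proof -
  let ?\<psi> = "\<lambda>x. \<phi> (x + (a - 1))"
  have dvd: "int n dvd int (gap x y) - (x - y + 1)" for x y
    using gap_cong[of x y] by (simp add: cong_iff_dvd_diff)
  interpret shifted: labelled_PT n A ?\<psi> "a - (a - 1)" "b - (a - 1)" "c - (a - 1)" "e - (a - 1)"
    by (rule labelled_shift)
  have ca: "[int n - int j = c - (a - 1)] (mod int n)"
    using dvd[of c a] j n unfolding gaps by (simp add: cong_iff_dvd_diff of_nat_diff algebra_simps)
  have ea: "[int j = e - (a - 1)] (mod int n)"
    using dvd[of e a] unfolding gaps by (simp add: cong_iff_dvd_diff algebra_simps)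
  have "int n dvd (int (gap c a) - (c - a + 1)) - (int (gap c b) - (c - b + 1))"
    by (intro dvd_diff dvd)
  moreover have "(int (gap c a) - (c - a + 1)) - (int (gap c b) - (c - b + 1)) = int d + 1 - (b - (a - 1))"
    unfolding gaps using j n by (simp add: of_nat_diff)
  ultimately have ba: "[int d + 1 = b - (a - 1)] (mod int n)" by (simp add: cong_iff_dvd_diff)
  have "labelled_PT n A ?\<psi> 1 (int d + 1) (int n - int j) (int j)"
    by (rule shifted.labelled_cong) (use ca ea ba in \<open>simp_all only: shifted.label_eq, simp\<close>)
  then show ?thesis using labelled_standard_form[OF n j] by (rule labelled_perm_similar)
qed

text \<open>Similarity pulls the labelling of the standard form back to A, where the exponents can
  be read off from the labels.\<close>

lemma perm_similar_standard_form_order: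
  assumes A: "A \<in> carrier_mat n n" and n: "n = 2 * d" and j: "1 \<le> j" "j < d"
    and two_part: "two_part j \<noteq> two_part (d - j)"
    and sim: "perm_similar n A (C_mat n + T_mat n 1 (n - j) (d + 1) j)"
  shows "has_finite_order A" "mult_order A = lcm (lcm (2 * j) (2 * d - 2 * j)) d"
proof -
  obtain \<phi> where "labelled_PT n A \<phi> 1 (int d + 1) (int n - int j) (int j)"
    using perm_similar_labelled[OF labelled_standard_form[OF n j] A sim] by blast
  then interpret labelled_PT n A \<phi> 1 "int d + 1" "int n - int j" "int j" .
  have "gap (int n - int j) 1 = n - j" "gap (int j) (int d + 1) = d + j"
    "gap (int n - int j) (int d + 1) = d - j" "gap (int j) 1 = j"
    by (rule gap_eqI; use n j in \<open>simp add: cong_iff_dvd_diff of_nat_diff\<close>)+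
  then show "has_finite_order A" "mult_order A = lcm (lcm (2 * j) (2 * d - 2 * j)) d"
    using finite_order[OF n j two_part] order_formula[OF n j two_part] by blast+
qed

theorem theorem4p5:
  fixes n :: nat and A :: "int mat"
  assumes "is_PT_type1 n A"
  shows "(has_finite_order A \<longleftrightarrow>
            even n \<and>
            (\<exists>d j. n = 2 * d \<and> 1 \<le> j \<and> j < d \<and> two_part j \<noteq> two_part (d - j) \<and>
               (perm_similar n A (C_mat n + T_mat n 1 (n - j) (d + 1) j) \<or>
                perm_similar n (transpose_mat A) (C_mat n + T_mat n 1 (n - j) (d + 1) j))))
       \<and> (\<forall>d j. n = 2 * d \<and> 1 \<le> j \<and> j < d \<and> two_part j \<noteq> two_part (d - j) \<and>
               (perm_similar n A (C_mat n + T_mat n 1 (n - j) (d + 1) j) \<or>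
                perm_similar n (transpose_mat A) (C_mat n + T_mat n 1 (n - j) (d + 1) j))
            \<longrightarrow> mult_order A = lcm (lcm (2 * j) (2 * d - 2 * j)) d)"
proof -
  obtain \<phi> a b c e where "labelled_PT n A \<phi> a b c e"
    using labelled_of_PT_type1[OF assms] by blast
  then interpret labelled_PT n A \<phi> a b c e .
  interpret transposed: labelled_PT n "transpose_mat A" "\<lambda>x. \<phi> (- x)" "- c" "- e" "- a" "- b"
    by (rule labelled_transpose)
  have order: "has_finite_order A \<and> mult_order A = lcm (lcm (2 * j) (2 * d - 2 * j)) d"
    if "n = 2 * d" "1 \<le> j" "j < d" "two_part j \<noteq> two_part (d - j)"
      "perm_similar n A (C_mat n + T_mat n 1 (n - j) (d + 1) j) \<or>
       perm_similar n (transpose_mat A) (C_mat n + T_mat n 1 (n - j) (d + 1) j)" for d j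
    using that(5)
  proof
    assume "perm_similar n A (C_mat n + T_mat n 1 (n - j) (d + 1) j)"
    then show ?thesis
      using perm_similar_standard_form_order[OF carrier that(1-4)] by blast
  next
    assume "perm_similar n (transpose_mat A) (C_mat n + T_mat n 1 (n - j) (d + 1) j)"
    then show ?thesis
      using perm_similar_standard_form_order[OF transposed.carrier that(1-4)]
      by (simp add: order_transpose[OF carrier])
  qed
  have form: "\<exists>d j. n = 2 * d \<and> 1 \<le> j \<and> j < d \<and> two_part j \<noteq> two_part (d - j) \<and>
      (perm_similar n A (C_mat n + T_mat n 1 (n - j) (d + 1) j) \<or>
       perm_similar n (transpose_mat A) (C_mat n + T_mat n 1 (n - j) (d + 1) j))"
    if finite_ord: "has_finite_order A"
  proof -
    obtain N where "N > 0" "A ^\<^sub>m N = 1\<^sub>m n"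
      using finite_ord carrier unfolding has_finite_order_def by auto
    from finite_order_gaps[OF this(2,1)] obtain d j where dj: "n = 2 * d" "1 \<le> j" "j < d"
      "two_part j \<noteq> two_part (d - j)" "gap c a = n - j"
      "gap c b = d - j \<and> gap e a = j \<or> gap c b = j \<and> gap e a = d - j"
      by metis
    \<comment> \<open>In the transposed labelling \<open>gap c a\<close> is unchanged while
      \<open>gap c b\<close> and \<open>gap e a\<close> trade places, so the second case is the
      first one for the transpose.\<close>
    have flip: "gap (- x) (- y) = gap y x" for x y by (simp add: gap_def)
    from dj(6) show ?thesis
    proof
      assume "gap c b = d - j \<and> gap e a = j"
      then show ?thesis using perm_similar_standard_form[OF dj(1,2,3,5)] dj by blast
    next
      assume "gap c b = j \<and> gap e a = d - j"
      then show ?thesis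
        using transposed.perm_similar_standard_form[OF dj(1,2,3), unfolded flip] dj by blast
    qed
  qed
  show ?thesis using order form by (metis dvd_triv_left)
qed

end
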